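(* Let $$0<\tau\le\min\left\{\frac{1}{4\|p\|_{1,\infty}},\ \frac{h^2}{16\,c_{0,inv}\|W(t)\|_M}\right\}=O(h^2).$$ Let $u_N,\xi_N\in X_{N,P}$ and let $\phi_N,\psi_N\in X_{N,P}$ satisfy, for all $v\in X_{N,P}$, $$\langle\psi_N-\tau\vec V(u_N)\cdot\nabla\psi_N+\tau\vec V(p)\cdot\nabla\phi_N,\,v\rangle_2=\langle\xi_N,v\rangle_2,\qquad\langle\phi_N,v\rangle_{H^1}=\langle\psi_N,v\rangle_2 .$$ Then $$\|\phi_N\|_2^2+\|\psi_N\|_2^2\le8\|\xi_N\|_2^2 .$$
   Context: $\Omega=(0,L)^2$; $\langle\cdot,\cdot\rangle_2$, $\|\cdot\|_2$ are the $L^2(\Omega)$ inner product and norm; $\langle u,v\rangle_{H^1}=\langle u,v\rangle_2+\langle\nabla u,\nabla v\rangle_2$, with norm $\|\cdot\|_{H^1}$. For a function $u$, $\vec V(u)=(-u_y,u_x)$. $p\in W^{1,\infty}(\Omega)$ is given, $\|p\|_{1,\infty}=\max\{\|p\|_{L^\infty},\|p_x\|_{L^\infty},\|p_y\|_{L^\infty}\}$ (with $1/0=+\infty$). Finite elements: $\overline\Omega$ is covered by an $n\times n$ tensor grid of nodes and a conforming structured triangulation based on it, with mesh size $h$. $X_N$ is the space of continuous functions on $\overline\Omega$ that are affine on each triangle; $X_{N,P}\subset X_N$ is the subspace of functions satisfying periodic boundary conditions (equal values at corresponding points of opposite sides of $\Omega$), of dimension $N=(n-1)^2$, with nodal basis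 $\varphi_1,\dots,\varphi_N$. $c_{0,inv}>0$ is a constant such that $\|v\|_{H^1}\le\frac{c_{0,inv}}{h}\|v\|_2$ for all $v\in X_N$. $M_{I,J}=\langle\varphi_I,\varphi_J\rangle_2$ and $\|a\|_M^2=a^TMa$ for $a\in\mathbb{R}^N$. $W(t)\in\mathbb{R}^N$ is a given vector (the coefficient vector of the already computed approximation $w_N(t)\in X_{N,P}$ at the current time $t$). *)

theory Defs
  imports "HOL-Analysis.Analysis" "HOL-Probability.Essential_Supremum"
begin

section \<open>Weak derivatives and function spaces\<close>

fun C_k :: "nat \<Rightarrow> (real \<times> real \<Rightarrow> real) \<Rightarrow> bool" where
  "C_k 0 f \<longleftrightarrow> continuous_on UNIV f"
| "C_k (Suc k) f \<longleftrightarrow> (\<forall>z. f differentiable (at z)) \<and>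
     (\<forall>e\<in>Basis. C_k k (\<lambda>z. frechet_derivative f (at z) e))"

text \<open>The space of smooth functions with compact support in \<open>\<Omega>\<close>.\<close>

definition test_functions :: "(real \<times> real) set \<Rightarrow> (real \<times> real \<Rightarrow> real) set" where
  "test_functions \<Omega> = {\<zeta>. (\<forall>k. C_k k \<zeta>) \<and>
     compact (closure {z. \<zeta> z \<noteq> 0}) \<and> closure {z. \<zeta> z \<noteq> 0} \<subseteq> \<Omega>}"

definition locally_integrable :: "(real \<times> real) set \<Rightarrow> (real \<times> real \<Rightarrow> real) \<Rightarrow> bool" where
  "locally_integrable \<Omega> u \<longleftrightarrow> (\<forall>K. compact K \<and> K \<subseteq> \<Omega> \<longrightarrow> u absolutely_integrable_on K)"

definition has_weak_partial ::
  "(real \<times> real) set \<Rightarrow> (real \<times> real \<Rightarrow> real) \<Rightarrow> real \<times> real \<Rightarrow> (real \<times> real \<Rightarrow> real) \<Rightarrow> bool" where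
  "has_weak_partial \<Omega> u e g \<longleftrightarrow> locally_integrable \<Omega> u \<and> locally_integrable \<Omega> g \<and>
     (\<forall>\<zeta>\<in>test_functions \<Omega>.
        (LINT z|lebesgue_on \<Omega>. u z * frechet_derivative \<zeta> (at z) e) =
        - (LINT z|lebesgue_on \<Omega>. g z * \<zeta> z))"

text \<open>A weak partial derivative is determined only almost everywhere (on open \<open>\<Omega>\<close>); the choice
  below picks one representative. It is unspecified if no weak partial derivative exists.\<close>

definition weak_partial ::
  "(real \<times> real) set \<Rightarrow> real \<times> real \<Rightarrow> (real \<times> real \<Rightarrow> real) \<Rightarrow> real \<times> real \<Rightarrow> real" where
  "weak_partial \<Omega> e u = (SOME g. has_weak_partial \<Omega> u e g)"

abbreviation weak_dx where "weak_dx \<Omega> \<equiv> weak_partial \<Omega> (1, 0)"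
abbreviation weak_dy where "weak_dy \<Omega> \<equiv> weak_partial \<Omega> (0, 1)"

definition grad ::
  "(real \<times> real) set \<Rightarrow> (real \<times> real \<Rightarrow> real) \<Rightarrow> real \<times> real \<Rightarrow> real \<times> real" where
  "grad \<Omega> u z = (weak_dx \<Omega> u z, weak_dy \<Omega> u z)"

definition Vvec ::
  "(real \<times> real) set \<Rightarrow> (real \<times> real \<Rightarrow> real) \<Rightarrow> real \<times> real \<Rightarrow> real \<times> real" where
  "Vvec \<Omega> u z = (- weak_dy \<Omega> u z, weak_dx \<Omega> u z)"

definition l2_inner ::
  "(real \<times> real) set \<Rightarrow> (real \<times> real \<Rightarrow> real) \<Rightarrow> (real \<times> real \<Rightarrow> real) \<Rightarrow> real" where
  "l2_inner \<Omega> u v = (LINT z|lebesgue_on \<Omega>. u z * v z)"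

definition l2_norm :: "(real \<times> real) set \<Rightarrow> (real \<times> real \<Rightarrow> real) \<Rightarrow> real" where
  "l2_norm \<Omega> u = sqrt (l2_inner \<Omega> u u)"

definition h1_inner ::
  "(real \<times> real) set \<Rightarrow> (real \<times> real \<Rightarrow> real) \<Rightarrow> (real \<times> real \<Rightarrow> real) \<Rightarrow> real" where
  "h1_inner \<Omega> u v = l2_inner \<Omega> u v + (LINT z|lebesgue_on \<Omega>. grad \<Omega> u z \<bullet> grad \<Omega> v z)"

definition h1_norm :: "(real \<times> real) set \<Rightarrow> (real \<times> real \<Rightarrow> real) \<Rightarrow> real" where
  "h1_norm \<Omega> u = sqrt (h1_inner \<Omega> u u)"

text \<open>The norm takes values in the extended reals; it is \<open>\<infinity>\<close> for non-measurable functions.\<close>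

definition linf_norm :: "(real \<times> real) set \<Rightarrow> (real \<times> real \<Rightarrow> real) \<Rightarrow> ereal" where
  "linf_norm \<Omega> u = esssup (lebesgue_on \<Omega>) (\<lambda>z. ereal \<bar>u z\<bar>)"

definition L_inf :: "(real \<times> real) set \<Rightarrow> (real \<times> real \<Rightarrow> real) set" where
  "L_inf \<Omega> = {u. u \<in> borel_measurable (lebesgue_on \<Omega>) \<and> linf_norm \<Omega> u < \<infinity>}"

definition W1_inf :: "(real \<times> real) set \<Rightarrow> (real \<times> real \<Rightarrow> real) set" where
  "W1_inf \<Omega> = {u \<in> L_inf \<Omega>. \<forall>e\<in>Basis. \<exists>g\<in>L_inf \<Omega>. has_weak_partial \<Omega> u e g}"

definition w1_inf_norm :: "(real \<times> real) set \<Rightarrow> (real \<times> real \<Rightarrow> real) \<Rightarrow> ereal" where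
  "w1_inf_norm \<Omega> u =
     Max {linf_norm \<Omega> u, linf_norm \<Omega> (weak_dx \<Omega> u), linf_norm \<Omega> (weak_dy \<Omega> u)}"

section \<open>Finite elements on the square\<close>

definition square :: "real \<Rightarrow> (real \<times> real) set" where
  "square L = {0<..<L} \<times> {0<..<L}"

definition closed_square :: "real \<Rightarrow> (real \<times> real) set" where
  "closed_square L = {0..L} \<times> {0..L}"

definition grid_1d :: "real \<Rightarrow> nat \<Rightarrow> (nat \<Rightarrow> real) \<Rightarrow> bool" where
  "grid_1d L n x \<longleftrightarrow> 2 \<le> n \<and> x 0 = 0 \<and> x (n - 1) = L \<and> (\<forall>i<n - 1. x i < x (Suc i))"

text \<open>The two triangles obtained by cutting the grid cell with lower left node \<open>(x i, y j)\<close> along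
  one of its diagonals; \<open>d\<close> selects the diagonal.\<close>

definition cell_triangles ::
  "(nat \<Rightarrow> real) \<Rightarrow> (nat \<Rightarrow> real) \<Rightarrow> bool \<Rightarrow> nat \<Rightarrow> nat \<Rightarrow> (real \<times> real) set set" where
  "cell_triangles x y d i j =
     (let ll = (x i, y j); lr = (x (Suc i), y j);
          ul = (x i, y (Suc j)); ur = (x (Suc i), y (Suc j))
      in if d then {convex hull {ll, lr, ur}, convex hull {ll, ul, ur}}
         else {convex hull {ll, lr, ul}, convex hull {lr, ul, ur}})"

text \<open>A conforming triangulation whose vertices are the nodes of an \<open>n \<times> n\<close> tensor grid. The choice
  of the diagonal in each cell is left free, so every uniform pattern is included.\<close>

definition structured_triangulation ::
  "real \<Rightarrow> nat \<Rightarrow> (nat \<Rightarrow> real) \<Rightarrow> (nat \<Rightarrow> real) \<Rightarrow> (real \<times> real) set set \<Rightarrow> bool" where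
  "structured_triangulation L n x y T \<longleftrightarrow> grid_1d L n x \<and> grid_1d L n y \<and>
     (\<exists>d. T = (\<Union>i<n - 1. \<Union>j<n - 1. cell_triangles x y (d i j) i j))"

definition mesh_size :: "(real \<times> real) set set \<Rightarrow> real" where
  "mesh_size T = Max (diameter ` T)"

text \<open>Elements of the finite element spaces are functions on the closed square; their values
  elsewhere are irrelevant.\<close>

definition X_N :: "real \<Rightarrow> (real \<times> real) set set \<Rightarrow> (real \<times> real \<Rightarrow> real) set" where
  "X_N L T = {v. continuous_on (closed_square L) v \<and>
     (\<forall>K\<in>T. \<exists>a b c. \<forall>(s, t)\<in>K. v (s, t) = a + b * s + c * t)}"

definition X_NP :: "real \<Rightarrow> (real \<times> real) set set \<Rightarrow> (real \<times> real \<Rightarrow> real) set" where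
  "X_NP L T = {v \<in> X_N L T. \<forall>s\<in>{0..L}. v (0, s) = v (L, s) \<and> v (s, 0) = v (s, L)}"

text \<open>Periodicity identifies the last row (column) of nodes with the first one. The remaining
  \<open>(n - 1)\<^sup>2\<close> nodes are numbered lexicographically from \<open>0\<close>.\<close>

definition node :: "nat \<Rightarrow> (nat \<Rightarrow> real) \<Rightarrow> (nat \<Rightarrow> real) \<Rightarrow> nat \<Rightarrow> real \<times> real" where
  "node n x y I = (x (I mod (n - 1)), y (I div (n - 1)))"

definition nodal_basis ::
  "real \<Rightarrow> nat \<Rightarrow> (nat \<Rightarrow> real) \<Rightarrow> (nat \<Rightarrow> real) \<Rightarrow> (real \<times> real) set set \<Rightarrow>
   (nat \<Rightarrow> real \<times> real \<Rightarrow> real) \<Rightarrow> bool" where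
  "nodal_basis L n x y T \<phi> \<longleftrightarrow> (\<forall>I<(n - 1)\<^sup>2. \<phi> I \<in> X_NP L T \<and>
     (\<forall>J<(n - 1)\<^sup>2. \<phi> I (node n x y J) = (if I = J then 1 else 0)))"

definition mass_matrix ::
  "(real \<times> real) set \<Rightarrow> (nat \<Rightarrow> real \<times> real \<Rightarrow> real) \<Rightarrow> nat \<Rightarrow> nat \<Rightarrow> real" where
  "mass_matrix \<Omega> \<phi> I J = l2_inner \<Omega> (\<phi> I) (\<phi> J)"

definition matrix_norm_vec :: "nat \<Rightarrow> (nat \<Rightarrow> nat \<Rightarrow> real) \<Rightarrow> (nat \<Rightarrow> real) \<Rightarrow> real" where
  "matrix_norm_vec N M a = sqrt (\<Sum>I<N. \<Sum>J<N. a I * M I J * a J)"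

end

theory Submission
  imports Defs
begin

text \<open>
  Testing the elliptic equation with \<open>\<phi>\<^sub>N\<close> gives, by Young's inequality,
  \<open>\<parallel>\<phi>\<^sub>N\<parallel>\<^sup>2 \<le> \<parallel>\<psi>\<^sub>N\<parallel>\<^sup>2\<close> and \<open>\<parallel>\<nabla>\<phi>\<^sub>N\<parallel>\<^sup>2 \<le> \<parallel>\<psi>\<^sub>N\<parallel>\<^sup>2 / 4\<close>. Testing the evolution equation with
  \<open>\<psi>\<^sub>N\<close>, the term in \<open>p\<close> is absorbed by means of the step size restriction, whereas the convection
  term in \<open>u\<^sub>N\<close> vanishes: on a triangle with vertices \<open>P, Q, R\<close> its integral is \<open>- 1 / 6\<close> times the
  sum over the oriented edges \<open>PQ, QR, RP\<close> of \<open>(u Q - u P) (v P\<^sup>2 + v P v Q + v Q\<^sup>2)\<close>, the discrete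
  form of Green's formula, and these edge terms cancel between neighbouring triangles and, by
  periodicity, on the boundary. As gradients are weak ones, picked by an arbitrary choice,
  they have to be identified almost everywhere with the classical gradients on the triangles.
\<close>

section \<open>Uniqueness of weak derivatives\<close>

text \<open>Because \<open>weak_partial\<close> is a \<open>SOME\<close> choice, no gradient can be
  computed before two facts are available: some explicit function is a weak derivative, and weak
  derivatives agree almost everywhere. The second rests on smooth cutoffs converging pointwise to
  indicators of boxes, so that no convolution is involved. The first rests on Fubini and integration
  by parts along coordinate lines, where continuity across the edges rules out jump terms. The
  quadratic factor of an edge PQ is three times the mean of v^2 over it, v being affine there. On a
  triangle V(u) is constant, hence (V(u) . grad v) v is the divergence of v^2 V(u) / 2, and the
  normal component of V(u) on a counterclockwise edge is minus the tangential derivative of u, a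
  constant as well. This produces the factor -1/6 and makes the identity exact. Swapping P and Q
  flips the sign of the edge term, and its value depends on vertex values only; this is why
  neighbouring triangles cancel.\<close>

fun smooth_upto :: "nat \<Rightarrow> (real \<Rightarrow> real) \<Rightarrow> bool" where
  "smooth_upto 0 f \<longleftrightarrow> continuous_on UNIV f"
| "smooth_upto (Suc k) f \<longleftrightarrow> (\<exists>f'. (\<forall>s. (f has_real_derivative f' s) (at s)) \<and> smooth_upto k f')"

lemma smooth_upto_imp_continuous: "smooth_upto k f \<Longrightarrow> continuous_on UNIV f"
  by (cases k) (auto intro!: DERIV_continuous_on[where D = "SOME f'. \<forall>s. (f has_real_derivative f' s) (at s)"]
      continuous_at_imp_continuous_on dest: DERIV_isCont)

lemma smooth_upto_SucD: "smooth_upto (Suc k) f \<Longrightarrow> smooth_upto k f"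
proof (induction k arbitrary: f)
  case 0
  then show ?case using smooth_upto_imp_continuous[OF 0] by simp
next
  case (Suc k)
  from Suc.prems obtain f' where "\<forall>s. (f has_real_derivative f' s) (at s)" "smooth_upto (Suc k) f'"
    by auto
  with Suc.IH show ?case by auto
qed

lemma smooth_upto_add:
  "smooth_upto k f \<Longrightarrow> smooth_upto k g \<Longrightarrow> smooth_upto k (\<lambda>s. f s + g s)"
proof (induction k arbitrary: f g)
  case (Suc k)
  then obtain f' g' where f': "\<forall>s. (f has_real_derivative f' s) (at s)" "smooth_upto k f'"
    and g': "\<forall>s. (g has_real_derivative g' s) (at s)" "smooth_upto k g'" by auto
  have "\<forall>s. ((\<lambda>s. f s + g s) has_real_derivative f' s + g' s) (at s)"
    using f' g' by (auto intro!: derivative_eq_intros)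
  with Suc.IH[OF f'(2) g'(2)] show ?case by auto
qed (auto intro!: continuous_intros)

lemma smooth_upto_mult:
  "smooth_upto k f \<Longrightarrow> smooth_upto k g \<Longrightarrow> smooth_upto k (\<lambda>s. f s * g s)"
proof (induction k arbitrary: f g)
  case (Suc k)
  then obtain f' g' where f': "\<forall>s. (f has_real_derivative f' s) (at s)" "smooth_upto k f'"
    and g': "\<forall>s. (g has_real_derivative g' s) (at s)" "smooth_upto k g'" by auto
  have "\<forall>s. ((\<lambda>s. f s * g s) has_real_derivative f' s * g s + f s * g' s) (at s)"
    using f' g' by (auto intro!: derivative_eq_intros)
  moreover have "smooth_upto k (\<lambda>s. f' s * g s + f s * g' s)"
    using Suc.prems[THEN smooth_upto_SucD] f'(2) g'(2) by (intro smooth_upto_add Suc.IH)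
  ultimately show ?case by auto
qed (auto intro!: continuous_intros)

lemma smooth_upto_const: "smooth_upto k (\<lambda>_. c)"
  by (induction k arbitrary: c) (auto intro!: exI[of _ "\<lambda>_. 0"])

lemma smooth_upto_affine: "smooth_upto k f \<Longrightarrow> smooth_upto k (\<lambda>s. f (c * s + d))"
proof (induction k arbitrary: f)
  case 0
  then show ?case by (auto intro!: continuous_on_compose2[of UNIV f] continuous_intros)
next
  case (Suc k)
  then obtain f' where f': "\<forall>s. (f has_real_derivative f' s) (at s)" "smooth_upto k f'" by auto
  have "\<forall>s. ((\<lambda>s. f (c * s + d)) has_real_derivative f' (c * s + d) * c) (at s)"
    using f'(1) by (intro allI DERIV_chain2[where f = f]) (auto intro!: derivative_eq_intros)
  moreover have "smooth_upto k (\<lambda>s. f' (c * s + d) * c)"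
    using Suc.IH[OF f'(2)] by (intro smooth_upto_mult smooth_upto_const)
  ultimately show ?case by auto
qed

section \<open>Smooth cutoffs of intervals and boxes\<close>

definition inv_pow_exp :: "nat \<Rightarrow> real \<Rightarrow> real" where
  "inv_pow_exp m s = (if s > 0 then (1 / s) ^ m * exp (- (1 / s)) else 0)"

lemma inv_pow_exp_tendsto_0: "(inv_pow_exp m \<longlongrightarrow> 0) (at 0)"
proof (rule filterlim_split_at)
  have "((\<lambda>s. (1 / s) ^ m / exp (1 / s)) \<longlongrightarrow> 0) (at_right (0::real))"
    by (rule filterlim_compose[OF tendsto_power_div_exp_0])
       (simp add: filterlim_inverse_at_top_right flip: inverse_eq_divide)
  then show "(inv_pow_exp m \<longlongrightarrow> 0) (at_right 0)"
    by (rule Lim_transform_eventually)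
       (auto simp: eventually_at_right_field inv_pow_exp_def exp_minus divide_inverse intro!: exI[of _ 1])
  show "(inv_pow_exp m \<longlongrightarrow> 0) (at_left 0)"
    by (rule Lim_transform_eventually[OF tendsto_const])
       (auto simp: eventually_at_left_field inv_pow_exp_def intro!: exI[of _ "-1"])
qed

text \<open>The powers of 1/s are carried along because they make the family closed under
  differentiation up to linear combinations. Smoothness of the flat function
  \<open>inv_pow_exp 0\<close> then follows by an induction over all exponents at once.\<close>

lemma inv_pow_exp_derivative:
  "(inv_pow_exp m has_real_derivative
     inv_pow_exp (m + 2) s + (- real m) * inv_pow_exp (m + 1) s) (at s)"
proof -
  consider "s > 0" | "s < 0" | "s = 0" by linarith
  then show ?thesis
  proof cases
    case 1
    have "((\<lambda>s. (1 / s) ^ m * exp (- (1 / s))) has_real_derivative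
       inv_pow_exp (m + 2) s + (- real m) * inv_pow_exp (m + 1) s) (at s)"
    proof (cases m)
      case 0
      then show ?thesis using 1
        by (auto intro!: derivative_eq_intros simp: inv_pow_exp_def power2_eq_square)
    next
      case (Suc l)
      then show ?thesis using 1
        by (auto intro!: derivative_eq_intros
            simp: inv_pow_exp_def power2_eq_square field_simps power_eq_if[of s l])
    qed
    then show ?thesis
      by (rule has_field_derivative_transform_within_open[where S = "{0<..}"])
         (use 1 in \<open>auto simp: inv_pow_exp_def\<close>)
  next
    case 2
    have "((\<lambda>s. 0) has_real_derivative
       inv_pow_exp (m + 2) s + (- real m) * inv_pow_exp (m + 1) s) (at s)"
      using 2 by (simp add: inv_pow_exp_def)
    then show ?thesis
      by (rule has_field_derivative_transform_within_open[where S = "{..<0}"])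
         (use 2 in \<open>auto simp: inv_pow_exp_def\<close>)
  next
    case 3
    \<comment> \<open>The difference quotient at 0 is itself a member of the family, with exponent
      \<open>Suc m\<close>.\<close>
    have "((\<lambda>s. inv_pow_exp m s / s) \<longlongrightarrow> 0) (at 0)"
      by (rule Lim_transform_eventually[OF inv_pow_exp_tendsto_0[of "Suc m"]])
         (auto simp: inv_pow_exp_def)
    then show ?thesis using 3
      by (simp add: has_field_derivative_iff inv_pow_exp_def[of _ 0])
  qed
qed

lemma smooth_upto_inv_pow_exp: "smooth_upto k (inv_pow_exp m)"
proof (induction k arbitrary: m)
  case 0
  show ?case using inv_pow_exp_derivative
    by (auto intro!: continuous_at_imp_continuous_on dest: DERIV_isCont)
next
  case (Suc k)
  have "smooth_upto k (\<lambda>s. inv_pow_exp (m + 2) s + (- real m) * inv_pow_exp (m + 1) s)"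
    by (intro smooth_upto_add smooth_upto_mult smooth_upto_const Suc)
  with inv_pow_exp_derivative[of m] show ?case
    unfolding smooth_upto.simps by (intro exI conjI allI)
qed

text \<open>The scale \<open>k\<close> only steepens the flanks: exp(-1/(k s)) tends to 1 for each s
  > 0, while every bump vanishes off the same open interval.\<close>

definition bump :: "nat \<Rightarrow> real \<Rightarrow> real \<Rightarrow> real \<Rightarrow> real" where
  "bump k a b s = inv_pow_exp 0 (real k * (s - a)) * inv_pow_exp 0 (real k * (b - s))"

lemma smooth_upto_bump: "smooth_upto l (bump k a b)"
proof -
  have "smooth_upto l (\<lambda>s. inv_pow_exp 0 (real k * s + - real k * a) *
      inv_pow_exp 0 (- real k * s + real k * b))"
    by (intro smooth_upto_mult smooth_upto_affine smooth_upto_inv_pow_exp)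
  then show ?thesis by (simp add: bump_def[abs_def] algebra_simps)
qed

lemma bump_bounds: "0 \<le> bump k a b s" "bump k a b s \<le> 1"
  by (auto simp: bump_def inv_pow_exp_def intro!: mult_le_one)

lemma bump_nonzero: "bump k a b s \<noteq> 0 \<Longrightarrow> a < s \<and> s < b"
  by (auto simp: bump_def inv_pow_exp_def zero_less_mult_iff split: if_splits)

lemma inv_pow_exp_scale_tendsto: "s > 0 \<Longrightarrow> (\<lambda>k. inv_pow_exp 0 (real k * s)) \<longlonglongrightarrow> 1"
proof -
  assume s: "s > 0"
  have "(\<lambda>k. exp (- (inverse (real k) / s))) \<longlonglongrightarrow> exp (- (0 / s))"
    by (intro tendsto_intros lim_inverse_n) (use s in auto)
  then have "(\<lambda>k. exp (- (inverse (real k) / s))) \<longlonglongrightarrow> 1" by simp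
  then show ?thesis
    by (rule Lim_transform_eventually)
       (use s in \<open>auto simp: eventually_sequentially inv_pow_exp_def field_simps intro!: exI[of _ 1]\<close>)
qed

lemma bump_tendsto: "(\<lambda>k. bump k a b s) \<longlonglongrightarrow> indicator {a<..<b} s"
proof (cases "a < s \<and> s < b")
  case True
  then have "(\<lambda>k. bump k a b s) \<longlonglongrightarrow> 1 * 1"
    unfolding bump_def by (intro tendsto_mult inv_pow_exp_scale_tendsto) auto
  with True show ?thesis by simp
next
  case False
  then have "bump k a b s = 0" for k using bump_nonzero by blast
  with False show ?thesis by simp
qed

text \<open>Both partial derivatives of f(x) g(y) are again products of this shape, so the recursion
  of \<open>C_k\<close> over the basis directions closes when both factors are left arbitrary in the
  induction.\<close>

lemma smooth_upto_imp_C_k_product: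
  assumes "smooth_upto k f" "smooth_upto k g"
  shows "C_k k (\<lambda>z. f (fst z) * g (snd z))"
  using assms
proof (induction k arbitrary: f g)
  case 0
  then show ?case
    by (auto intro!: continuous_intros continuous_on_compose2[of UNIV f] continuous_on_compose2[of UNIV g])
next
  case (Suc k)
  from Suc.prems obtain f' g' where f': "\<And>s. (f has_real_derivative f' s) (at s)" "smooth_upto k f'"
    and g': "\<And>s. (g has_real_derivative g' s) (at s)" "smooth_upto k g'" by auto
  have der: "((\<lambda>z. f (fst z) * g (snd z)) has_derivative
      (\<lambda>w. f' (fst z) * fst w * g (snd z) + f (fst z) * (g' (snd z) * snd w))) (at z)" for z
  proof -
    have "((\<lambda>z. f (fst z)) has_derivative (\<lambda>w. f' (fst z) * fst w)) (at z)"
      using f'(1)[unfolded has_field_derivative_def] by (rule has_derivative_compose[OF has_derivative_fst[OF has_derivative_ident]])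
    moreover have "((\<lambda>z. g (snd z)) has_derivative (\<lambda>w. g' (snd z) * snd w)) (at z)"
      using g'(1)[unfolded has_field_derivative_def] by (rule has_derivative_compose[OF has_derivative_snd[OF has_derivative_ident]])
    ultimately show ?thesis
      by (rule has_derivative_mult[THEN has_derivative_eq_rhs]) (simp add: fun_eq_iff algebra_simps)
  qed
  have "frechet_derivative (\<lambda>z. f (fst z) * g (snd z)) (at z) =
     (\<lambda>w. f' (fst z) * fst w * g (snd z) + f (fst z) * (g' (snd z) * snd w))" for z
    using frechet_derivative_at[OF der] by simp
  moreover have "C_k k (\<lambda>z. f' (fst z) * g (snd z))" "C_k k (\<lambda>z. f (fst z) * g' (snd z))"
    using Suc.prems[THEN smooth_upto_SucD] f'(2) g'(2) by (auto intro!: Suc.IH)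
  moreover have "(\<lambda>z. f (fst z) * g (snd z)) differentiable (at z)" for z
    using der unfolding differentiable_def by blast
  ultimately show ?case by (auto simp: Basis_prod_def)
qed

definition box_bump :: "nat \<Rightarrow> real \<times> real \<Rightarrow> real \<times> real \<Rightarrow> real \<times> real \<Rightarrow> real" where
  "box_bump k a b z = bump k (fst a) (fst b) (fst z) * bump k (snd a) (snd b) (snd z)"

lemma mem_box_prod: "z \<in> box a b \<longleftrightarrow>
    fst a < fst z \<and> fst z < fst b \<and> snd a < snd z \<and> snd z < snd b"
  for z :: "real \<times> real"
  by (cases z; cases a; cases b) (auto simp: mem_box Basis_prod_def)

lemma box_bump_bounds: "0 \<le> box_bump k a b z" "box_bump k a b z \<le> 1"
  by (auto simp: box_bump_def bump_bounds intro!: mult_le_one)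

lemma box_bump_nonzero: "box_bump k a b z \<noteq> 0 \<Longrightarrow> z \<in> box a b"
  by (auto simp: box_bump_def mem_box_prod dest!: bump_nonzero)

text \<open>For positive \<open>k\<close> the cutoff is nonzero on the whole open box, so its
  support reaches the boundary of the box. Hence the hypothesis is about the closed box.\<close>

lemma box_bump_test_function:
  assumes "cbox a b \<subseteq> \<Omega>"
  shows "box_bump k a b \<in> test_functions \<Omega>"
proof -
  have sub: "closure {z. box_bump k a b z \<noteq> 0} \<subseteq> cbox a b"
    using box_bump_nonzero[of k a b] box_subset_cbox[of a b] by (intro closure_minimal closed_cbox) blast
  have "C_k l (box_bump k a b)" for l
    using smooth_upto_imp_C_k_product[OF smooth_upto_bump smooth_upto_bump]
    by (simp add: box_bump_def[abs_def])
  moreover have "compact (closure {z. box_bump k a b z \<noteq> 0})"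
    using sub by (meson bounded_cbox bounded_subset closed_closure compact_eq_bounded_closed)
  ultimately show ?thesis using sub assms by (auto simp: test_functions_def)
qed

lemma box_bump_continuous: "continuous_on UNIV (box_bump k a b)"
  using smooth_upto_imp_C_k_product[OF smooth_upto_bump[of 0] smooth_upto_bump[of 0]]
  by (simp add: box_bump_def[abs_def])

lemma box_bump_tendsto: "(\<lambda>k. box_bump k a b z) \<longlonglongrightarrow> indicator (box a b) z"
proof -
  have "(\<lambda>k. box_bump k a b z) \<longlonglongrightarrow>
      indicator {fst a<..<fst b} (fst z) * indicator {snd a<..<snd b} (snd z)"
    unfolding box_bump_def by (intro tendsto_mult bump_tendsto)
  then show ?thesis by (auto simp: indicator_def mem_box_prod of_bool_def split: if_splits)
qed

text \<open>Open boxes form an intersection-stable generator of the Borel sets, so the vanishing of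
  integrals spreads from boxes to all Borel sets by induction over disjoint unions and complements;
  a density with this property is zero almost everywhere.\<close>

lemma AE_zero_if_box_integrals_zero:
  fixes f :: "'a::euclidean_space \<Rightarrow> real"
  assumes f: "integrable lborel f"
    and box: "\<And>a b. (LINT z:box a b|lborel. f z) = 0"
  shows "AE z in lborel. f z = 0"
proof (rule sigma_finite_measure.density_zero[OF lborel.sigma_finite_measure_axioms f])
  note [measurable] = borel_measurable_integrable[OF f]
  have int: "set_integrable lborel A f" if "A \<in> sets borel" for A
    using f that unfolding set_integrable_def by (intro integrable_mult_indicator) auto
  \<comment> \<open>The complement step needs the integral over the whole space to vanish. The space
    is no box, so it is exhausted by growing cubes.\<close>
  have lim: "(\<lambda>k. LINT z:box (- (real k *\<^sub>R One)) (real k *\<^sub>R One)|lborel. f z) \<longlonglongrightarrow> (LINT z|lborel. f z)"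
    unfolding set_lebesgue_integral_def
  proof (rule integral_dominated_convergence[where w = "\<lambda>z. norm (f z)"])
    show "AE z in lborel. (\<lambda>k. indicator (box (- (real k *\<^sub>R One)) (real k *\<^sub>R One)) z *\<^sub>R f z) \<longlonglongrightarrow> f z"
    proof (intro AE_I2 tendsto_eventually)
      fix z :: 'a
      obtain k0 where k0: "norm z < real k0" using reals_Archimedean2 by blast
      have "z \<in> box (- (real k *\<^sub>R One)) (real k *\<^sub>R One)" if "k \<ge> k0" for k
        using k0 that Basis_le_norm[of _ z] by (fastforce simp: mem_box abs_less_iff)
      then show "\<forall>\<^sub>F k in sequentially. indicator (box (- (real k *\<^sub>R One)) (real k *\<^sub>R One)) z *\<^sub>R f z = f z"
        unfolding eventually_sequentially by (intro exI[of _ k0]) auto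
    qed
  qed (use f in \<open>auto simp: indicator_def\<close>)
  then have tot: "(LINT z|lborel. f z) = 0"
    unfolding box by (simp add: LIMSEQ_const_iff)
  fix A :: "'a set" assume "A \<in> sets lborel"
  then have A: "A \<in> sigma_sets UNIV (range (\<lambda>(a, b). box a b :: 'a set))"
    by (simp add: borel_eq_box sets_measure_of)
  have "Int_stable (range (\<lambda>(a, b). box a b :: 'a set))"
    by (auto simp: Int_stable_def box_Int_box simp del: box_eq_empty intro!: rev_image_eqI[of "(_, _)"])
  moreover have "range (\<lambda>(a, b). box a b :: 'a set) \<subseteq> Pow UNIV" by simp
  ultimately show "(LINT z:A|lborel. f z) = 0"
    using A
  proof (induction rule: sigma_sets_induct_disjoint)
    case (basic A)
    then show ?case using box by auto
  next
    case empty
    then show ?case by (simp add: set_lebesgue_integral_def)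
  next
    case (compl A)
    then have A: "A \<in> sets borel" by (simp add: borel_eq_box sets_measure_of)
    have "(LINT z:(UNIV - A) \<union> A|lborel. f z) =
        (LINT z:UNIV - A|lborel. f z) + (LINT z:A|lborel. f z)"
      using A by (intro set_integral_Un int) auto
    moreover have "(LINT z:(UNIV - A) \<union> A|lborel. f z) = 0"
      using tot by (simp add: set_lebesgue_integral_def)
    ultimately show ?case using compl by simp
  next
    case (union A)
    then have A: "A i \<in> sets borel" for i by (auto simp: borel_eq_box sets_measure_of)
    have "(LINT z:(\<Union>i. A i)|lborel. f z) = (\<Sum>i. LINT z:A i|lborel. f z)"
      using union(1) A by (intro lebesgue_integral_countable_add int) (auto simp: disjoint_family_on_def)
    then show ?case using union by simp
  qed
qed


text \<open>Tested with the same cutoff, both derivatives give the same number, so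
  \<open>g1 - g2\<close> is orthogonal to every \<open>box_bump k a b\<close>. Letting
  \<open>k\<close> tend to infinity replaces the cutoff by the indicator; local integrability on the
  compact box supplies the dominating function.\<close>

lemma weak_partial_integral_diff_box:
  assumes \<Omega>: "open \<Omega>" and sub: "cbox a b \<subseteq> \<Omega>"
    and g1: "has_weak_partial \<Omega> u e g1" and g2: "has_weak_partial \<Omega> u e g2"
  shows "(LINT z|lebesgue. indicator (box a b) z * (g1 z - g2 z)) = 0"
    and "integrable lebesgue (\<lambda>z. indicator (box a b) z * (g1 z - g2 z))"
proof -
  have int: "integrable lebesgue (\<lambda>z. indicator (cbox a b) z * g z)"
    if "has_weak_partial \<Omega> u e g" for g
    using that sub unfolding has_weak_partial_def locally_integrable_def set_integrable_def
    by (metis (no_types, lifting) compact_cbox real_scaleR_def set_integrable_def Bochner_Integration.integrable_cong)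
  have [measurable]: "box_bump k a b \<in> borel_measurable lebesgue" for k
    by (intro measurable_completion) (simp add: borel_measurable_continuous_onI box_bump_continuous)
  have intb: "integrable lebesgue (\<lambda>z. indicator (cbox a b) z * g z * box_bump k a b z)"
    if "has_weak_partial \<Omega> u e g" for g k
  proof (rule Bochner_Integration.integrable_bound[OF int[OF that]])
    show "(\<lambda>z. indicator (cbox a b) z * g z * box_bump k a b z) \<in> borel_measurable lebesgue"
      using borel_measurable_integrable[OF int[OF that]] by measurable
  qed (auto simp: abs_mult box_bump_bounds intro!: AE_I2 mult_left_le)
  have bump_eq: "indicator \<Omega> z * (g z * box_bump k a b z) =
      indicator (cbox a b) z * g z * box_bump k a b z" for g :: "real \<times> real \<Rightarrow> real" and k z
    using box_bump_nonzero[of k a b z] box_subset_cbox[of a b] sub by (auto simp: indicator_def)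
  have eq: "(LINT z|lebesgue_on \<Omega>. g z * box_bump k a b z) =
      (LINT z|lebesgue. indicator (cbox a b) z * g z * box_bump k a b z)" for g k
    using \<Omega> by (subst integral_restrict_space) (auto simp: bump_eq)
  have zero: "(LINT z|lebesgue. (indicator (cbox a b) z * g1 z - indicator (cbox a b) z * g2 z) * box_bump k a b z) = 0" for k
  proof -
    have "(LINT z|lebesgue_on \<Omega>. g1 z * box_bump k a b z) = (LINT z|lebesgue_on \<Omega>. g2 z * box_bump k a b z)"
    proof -
      have "- (LINT z|lebesgue_on \<Omega>. g z * box_bump k a b z) =
          (LINT z|lebesgue_on \<Omega>. u z * frechet_derivative (box_bump k a b) (at z) e)"
        if "has_weak_partial \<Omega> u e g" for g
        using that box_bump_test_function[OF sub, of k] by (simp add: has_weak_partial_def)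
      from this[OF g1] this[OF g2] show ?thesis by linarith
    qed
    then show ?thesis
      unfolding left_diff_distrib
      by (subst Bochner_Integration.integral_diff[OF intb[OF g1] intb[OF g2]]) (simp add: eq)
  qed
  have lim: "(\<lambda>k. LINT z|lebesgue. (indicator (cbox a b) z * g1 z - indicator (cbox a b) z * g2 z) * box_bump k a b z)
      \<longlonglongrightarrow> (LINT z|lebesgue. (indicator (cbox a b) z * g1 z - indicator (cbox a b) z * g2 z) * indicator (box a b) z)"
  proof (rule integral_dominated_convergence[where
        w = "\<lambda>z. norm (indicator (cbox a b) z * g1 z - indicator (cbox a b) z * g2 z)"])
    show "(\<lambda>z. (indicator (cbox a b) z * g1 z - indicator (cbox a b) z * g2 z) * box_bump k a b z)
        \<in> borel_measurable lebesgue" for k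
      using intb[OF g1, of k] intb[OF g2, of k] by (simp add: left_diff_distrib)
    show "(\<lambda>z. (indicator (cbox a b) z * g1 z - indicator (cbox a b) z * g2 z) * indicator (box a b) z)
        \<in> borel_measurable lebesgue"
      using int[OF g1] int[OF g2]
      by (intro borel_measurable_times[OF borel_measurable_diff borel_measurable_indicator]) auto
    show "integrable lebesgue (\<lambda>z. norm (indicator (cbox a b) z * g1 z - indicator (cbox a b) z * g2 z))"
      using int[OF g1] int[OF g2] by auto
  qed (auto intro!: AE_I2 tendsto_mult box_bump_tendsto mult_left_le simp: abs_mult box_bump_bounds)
  have ind: "(indicator (cbox a b) z * g1 z - indicator (cbox a b) z * g2 z) * indicator (box a b) z
      = indicator (box a b) z * (g1 z - g2 z)" for z
    using box_subset_cbox[of a b] by (auto simp: indicator_def)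
  show "(LINT z|lebesgue. indicator (box a b) z * (g1 z - g2 z)) = 0"
    using lim unfolding zero ind by (simp add: LIMSEQ_const_iff)
  have "integrable lebesgue (\<lambda>z. (indicator (cbox a b) z * g1 z - indicator (cbox a b) z * g2 z) * indicator (box a b) z)"
    using int[OF g1] int[OF g2] by (intro integrable_real_mult_indicator) auto
  then show "integrable lebesgue (\<lambda>z. indicator (box a b) z * (g1 z - g2 z))"
    unfolding ind .
qed

text \<open>The difference, cut off to the box, is only Lebesgue measurable. It is exchanged for a
  Borel representative \<open>f\<close> so that the criterion on box integrals applies.\<close>

lemma weak_partial_unique_AE_box:
  assumes \<Omega>: "open \<Omega>" and sub: "cbox a b \<subseteq> \<Omega>"
    and g1: "has_weak_partial \<Omega> u e g1" and g2: "has_weak_partial \<Omega> u e g2"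
  shows "AE z in lebesgue. z \<in> box a b \<longrightarrow> g1 z = g2 z"
proof -
  define d where "d z = indicator (box a b) z * (g1 z - g2 z)" for z
  have d: "integrable lebesgue d"
    using weak_partial_integral_diff_box(2)[OF assms] by (simp add: d_def[abs_def])
  obtain f where f [measurable]: "f \<in> borel_measurable lborel" and fd: "AE z in lborel. d z = f z"
    using completion_ex_borel_measurable_real[OF borel_measurable_integrable[OF d]] by auto
  have fd': "AE z in lebesgue. d z = f z"
    using fd by (rule AE_completion)
  have "integrable lebesgue f"
    using d fd' f by (subst integrable_cong_AE[symmetric, of d]) (auto intro: measurable_completion)
  then have fint: "integrable lborel f"
    using f by (simp add: integrable_completion)
  have "AE z in lborel. f z = 0"
  proof (rule AE_zero_if_box_integrals_zero[OF fint])
    fix c d' :: "real \<times> real"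
    obtain p q where pq: "box c d' \<inter> box a b = box p q"
      unfolding box_Int_box by blast
    have "(LINT z:box c d'|lborel. f z) = (LINT z|lebesgue. indicator (box c d') z * f z)"
      unfolding set_lebesgue_integral_def by (subst integral_completion) auto
    also have "\<dots> = (LINT z|lebesgue. indicator (box c d') z * d z)"
      using fd' f borel_measurable_integrable[OF d]
      by (intro integral_cong_AE) (auto intro!: borel_measurable_times intro: measurable_completion)
    also have "\<dots> = (LINT z|lebesgue. indicator (box p q) z * (g1 z - g2 z))"
      unfolding d_def pq[symmetric] by (simp add: indicator_inter_arith mult.assoc)
    also have "\<dots> = 0"
    \<comment> \<open>A nonempty \<open>box p q\<close> has closure \<open>cbox p q\<close>, which
      therefore stays inside \<open>cbox a b\<close>. For an empty box this inclusion could fail,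
      but then the integral is trivially zero.\<close>
    proof (cases "box p q = {}")
      case False
      then have "cbox p q \<subseteq> cbox a b"
        using pq box_subset_cbox[of a b] by (metis closure_box closure_minimal closed_cbox le_infI2 order_refl order_trans)
      with sub show ?thesis
        by (intro weak_partial_integral_diff_box(1)[OF \<Omega> _ g1 g2]) auto
    qed auto
    finally show "(LINT z:box c d'|lborel. f z) = 0" .
  qed
  then have "AE z in lebesgue. f z = 0"
    by (rule AE_completion)
  with fd' show ?thesis
    by eventually_elim (auto simp: d_def indicator_def)
qed

text \<open>Countably many closed boxes exhaust an open set, so the exceptional sets, box boundaries
  included, add up to a null set.\<close>

lemma weak_partial_unique_AE:
  assumes \<Omega>: "open \<Omega>"
    and g1: "has_weak_partial \<Omega> u e g1" and g2: "has_weak_partial \<Omega> u e g2"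
  shows "AE z in lebesgue_on \<Omega>. g1 z = g2 z"
proof -
  obtain D where "countable D" and D: "D \<subseteq> Pow \<Omega>" "\<And>X. X \<in> D \<Longrightarrow> \<exists>a b. X = cbox a b" "\<Union>D = \<Omega>"
    using open_countable_Union_open_cbox[OF \<Omega>] by metis
  have "AE z in lebesgue. \<forall>X\<in>D. z \<in> X \<longrightarrow> g1 z = g2 z"
  proof (rule AE_ball_countable'[OF _ \<open>countable D\<close>])
    fix X assume X: "X \<in> D"
    then obtain a b where ab: "X = cbox a b" using D by blast
    have "AE z in lebesgue. z \<notin> cbox a b - box a b"
      using negligible_frontier_interval[of a b] by (intro AE_not_in) (simp add: negligible_iff_null_sets)
    moreover have "AE z in lebesgue. z \<in> box a b \<longrightarrow> g1 z = g2 z"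
      using X D ab by (intro weak_partial_unique_AE_box[OF \<Omega> _ g1 g2]) auto
    ultimately show "AE z in lebesgue. z \<in> X \<longrightarrow> g1 z = g2 z"
      by eventually_elim (auto simp: ab)
  qed
  then have "AE z in lebesgue. z \<in> \<Omega> \<longrightarrow> g1 z = g2 z"
    by eventually_elim (use D in auto)
  with \<Omega> show ?thesis by (subst AE_restrict_space_iff) auto
qed

section \<open>Triangulated squares\<close>

lemma grid_1d_locate:
  assumes "grid_1d L n x" "0 < s" "s < L"
  obtains i where "i < n - 1" "x i \<le> s" "s < x (Suc i)"
proof -
  define k where "k = (LEAST k. s < x k)"
  have ex: "s < x (n - 1)" using assms by (simp add: grid_1d_def)
  have k: "s < x k" "k \<le> n - 1"
    unfolding k_def using ex by (auto intro: LeastI Least_le)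
  have "k \<noteq> 0" using k(1) assms by (intro notI) (simp add: grid_1d_def)
  then obtain i where i: "k = Suc i" by (cases k) auto
  have "\<not> s < x i" using not_less_Least[of i "\<lambda>k. s < x k"] i k_def by simp
  with k i show ?thesis by (intro that[of i]) auto
qed

lemma grid_1d_less:
  assumes "grid_1d L n x" "i < j" "j \<le> n - 1"
  shows "x i < x j"
  using assms(2,3)
proof (induction j)
  case (Suc j)
  then have "x j < x (Suc j)" using assms(1) by (auto simp: grid_1d_def)
  with Suc show ?case by (cases "i = j") auto
qed auto

lemma grid_1d_le:
  assumes "grid_1d L n x" "i \<le> j" "j \<le> n - 1"
  shows "x i \<le> x j"
  using grid_1d_less[OF assms(1), of i j] assms by (cases "i = j") auto

lemma grid_1d_interval_unique:
  assumes "grid_1d L n x" "i < n - 1" "j < n - 1" "x i < s" "s < x (Suc i)" "x j < s" "s < x (Suc j)"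
  shows "i = j"
proof (rule ccontr)
  assume "i \<noteq> j"
  then consider "Suc i \<le> j" | "Suc j \<le> i" by linarith
  then show False
    using grid_1d_le[OF assms(1), of "Suc i" j] grid_1d_le[OF assms(1), of "Suc j" i] assms
    by cases auto
qed

section \<open>Geometry of cells, diagonals and triangles\<close>

locale square_triangulation =
  fixes L :: real and n :: nat and x y :: "nat \<Rightarrow> real" and d :: "nat \<Rightarrow> nat \<Rightarrow> bool"
  assumes grid_x: "grid_1d L n x" and grid_y: "grid_1d L n y"
begin

text \<open>The diagonal of a cell is the graph of \<open>diagonal i j\<close> as a function of the second coordinate.\<close>

definition diagonal_bot :: "nat \<Rightarrow> nat \<Rightarrow> real" where
  "diagonal_bot i j = (if d i j then x i else x (Suc i))"

definition diagonal_top :: "nat \<Rightarrow> nat \<Rightarrow> real" where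
  "diagonal_top i j = (if d i j then x (Suc i) else x i)"

definition diagonal_slope :: "nat \<Rightarrow> nat \<Rightarrow> real" where
  "diagonal_slope i j = (diagonal_top i j - diagonal_bot i j) / (y (Suc j) - y j)"

definition diagonal :: "nat \<Rightarrow> nat \<Rightarrow> real \<Rightarrow> real" where
  "diagonal i j t = diagonal_bot i j + (t - y j) * diagonal_slope i j"

text \<open>The last component of an index selects the triangle to the right of the diagonal.\<close>

definition indices :: "(nat \<times> nat \<times> bool) set" where
  "indices = {..<n - 1} \<times> {..<n - 1} \<times> UNIV"

text \<open>Inequalities replace convex hulls here because they expose the sections by coordinate
  lines, which both the integration by parts and the exact integrals work with. Hulls enter only
  through \<open>closed_triangle_subset_triangles\<close>.\<close>

definition open_triangle :: "nat \<times> nat \<times> bool \<Rightarrow> (real \<times> real) set" where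
  "open_triangle = (\<lambda>(i, j, r). {(s, t). x i < s \<and> s < x (Suc i) \<and> y j < t \<and> t < y (Suc j) \<and>
     (if r then diagonal i j t < s else s < diagonal i j t)})"

definition closed_triangle :: "nat \<times> nat \<times> bool \<Rightarrow> (real \<times> real) set" where
  "closed_triangle = (\<lambda>(i, j, r). {(s, t). x i \<le> s \<and> s \<le> x (Suc i) \<and> y j \<le> t \<and> t \<le> y (Suc j) \<and>
     (if r then diagonal i j t \<le> s else s \<le> diagonal i j t)})"

definition triangles :: "(real \<times> real) set set" where
  "triangles = (\<Union>i<n - 1. \<Union>j<n - 1. cell_triangles x y (d i j) i j)"

abbreviation skeleton :: "(real \<times> real) set" where
  "skeleton \<equiv> square L - \<Union>(open_triangle ` indices)"

lemma x_step: "i < n - 1 \<Longrightarrow> x i < x (Suc i)" and y_step: "j < n - 1 \<Longrightarrow> y j < y (Suc j)"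
  using grid_x grid_y by (auto simp: grid_1d_def)

lemma L_pos: "0 < L"
  using grid_1d_less[OF grid_x, of 0 "n - 1"] grid_x by (auto simp: grid_1d_def)

lemma finite_indices: "finite indices"
  by (simp add: indices_def)

lemma open_square: "open (square L)"
  unfolding square_def by (intro open_Times) auto

lemma bounded_square: "bounded (square L)"
  unfolding square_def by (intro bounded_Times) auto

lemma open_open_triangle: "open (open_triangle k)"
proof -
  obtain i j r where k: "k = (i, j, r)" by (cases k)
  have "open {z. x i < fst z \<and> fst z < x (Suc i) \<and> y j < snd z \<and> snd z < y (Suc j) \<and>
     (if r then diagonal i j (snd z) < fst z else fst z < diagonal i j (snd z))}"
    unfolding diagonal_def
    by (cases r) (auto intro!: open_Collect_conj open_Collect_less continuous_intros)
  then show ?thesis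
    by (cases r) (simp_all add: open_triangle_def k case_prod_unfold)
qed

lemma open_triangle_subset_closed: "open_triangle k \<subseteq> closed_triangle k"
  by (auto simp: open_triangle_def closed_triangle_def split: if_splits)

lemma open_triangle_subset_square: "k \<in> indices \<Longrightarrow> open_triangle k \<subseteq> square L"
proof -
  assume "k \<in> indices"
  then obtain i j r where k: "k = (i, j, r)" "i < n - 1" "j < n - 1" by (auto simp: indices_def)
  then have "0 \<le> x i" "x (Suc i) \<le> L" "0 \<le> y j" "y (Suc j) \<le> L"
    using grid_1d_le[OF grid_x, of 0 i] grid_1d_le[OF grid_x, of "Suc i" "n - 1"]
      grid_1d_le[OF grid_y, of 0 j] grid_1d_le[OF grid_y, of "Suc j" "n - 1"] grid_x grid_y
    by (auto simp: grid_1d_def)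
  then show ?thesis by (auto simp: open_triangle_def square_def k)
qed

lemma open_triangle_unique:
  assumes "k \<in> indices" "l \<in> indices" "z \<in> open_triangle k" "z \<in> open_triangle l"
  shows "k = l"
proof -
  obtain i j r i' j' r' where kl: "k = (i, j, r)" "l = (i', j', r')" by (cases k; cases l)
  have "i = i'" "j = j'"
    using assms kl by (auto simp: indices_def open_triangle_def
        intro: grid_1d_interval_unique[OF grid_x, where s = "fst z"] grid_1d_interval_unique[OF grid_y, where s = "snd z"])
  with assms kl show ?thesis
    by (auto simp: open_triangle_def split: if_splits)
qed

text \<open>Each edge is enlarged to a full line. The crude superset is enough to count
  intersections with coordinate lines and to see that the edges are negligible.\<close>

lemma skeleton_subset:
  assumes "(s, t) \<in> skeleton"
  shows "s \<in> x ` {..<n} \<or> t \<in> y ` {..<n} \<or> (\<exists>i<n - 1. \<exists>j<n - 1. s = diagonal i j t)"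
proof -
  have "0 < s" "s < L" "0 < t" "t < L" using assms by (auto simp: square_def)
  then obtain i j where i: "i < n - 1" "x i \<le> s" "s < x (Suc i)" and j: "j < n - 1" "y j \<le> t" "t < y (Suc j)"
    using grid_1d_locate[OF grid_x] grid_1d_locate[OF grid_y] by metis
  have "(s, t) \<notin> open_triangle (i, j, True)" "(s, t) \<notin> open_triangle (i, j, False)"
    using assms i j by (auto simp: indices_def)
  then have "s = x i \<or> t = y j \<or> s = diagonal i j t"
    using i j by (auto simp: open_triangle_def)
  then show ?thesis using i j by fastforce
qed

lemma diagonal_slope_nonzero: "i < n - 1 \<Longrightarrow> j < n - 1 \<Longrightarrow> diagonal_slope i j \<noteq> 0"
  using x_step[of i] y_step[of j]
  by (auto simp: diagonal_slope_def diagonal_bot_def diagonal_top_def)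

text \<open>Off the node heights, a row crosses each diagonal once. Finiteness is what lets the
  fundamental theorem of calculus be applied along the whole row despite the kinks.\<close>

lemma finite_skeleton_row:
  assumes "t \<notin> y ` {..<n}"
  shows "finite {s. (s, t) \<in> skeleton}"
proof (rule finite_subset)
  show "{s. (s, t) \<in> skeleton} \<subseteq> x ` {..<n} \<union> (\<Union>i<n - 1. \<Union>j<n - 1. {diagonal i j t})"
  proof
    fix s assume "s \<in> {s. (s, t) \<in> skeleton}"
    then show "s \<in> x ` {..<n} \<union> (\<Union>i<n - 1. \<Union>j<n - 1. {diagonal i j t})"
      using skeleton_subset[of s t] assms by auto
  qed
  show "finite (x ` {..<n} \<union> (\<Union>i<n - 1. \<Union>j<n - 1. {diagonal i j t}))"
    by (intro finite_UnI finite_imageI finite_UN_I) auto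
qed

lemma finite_skeleton_column:
  assumes "s \<notin> x ` {..<n}"
  shows "finite {t. (s, t) \<in> skeleton}"
proof (rule finite_subset)
  \<comment> \<open>The equation of the diagonal solved for the second coordinate, possible because
    a diagonal is never vertical in the plane (\<open>diagonal_slope_nonzero\<close>).\<close>
  let ?f = "\<lambda>i j. y j + (s - diagonal_bot i j) / diagonal_slope i j"
  show "{t. (s, t) \<in> skeleton} \<subseteq> y ` {..<n} \<union> (\<Union>i<n - 1. \<Union>j<n - 1. {?f i j})"
  proof
    fix t assume "t \<in> {t. (s, t) \<in> skeleton}"
    then consider "t \<in> y ` {..<n}" | i j where "i < n - 1" "j < n - 1" "s = diagonal i j t"
      using skeleton_subset[of s t] assms by auto
    then show "t \<in> y ` {..<n} \<union> (\<Union>i<n - 1. \<Union>j<n - 1. {?f i j})"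
    proof cases
      case (2 i j)
      then have "t = ?f i j"
        using diagonal_slope_nonzero[of i j] by (simp add: diagonal_def)
      with 2 show ?thesis by blast
    qed simp
  qed
  show "finite (y ` {..<n} \<union> (\<Union>i<n - 1. \<Union>j<n - 1. {?f i j}))"
    by (intro finite_UnI finite_imageI finite_UN_I) auto
qed

lemma negligible_skeleton: "negligible skeleton"
proof (rule negligible_subset)
  have hyp: "negligible {z :: real \<times> real. fst z = c + snd z * m}" for c m
  proof -
    have "{z :: real \<times> real. fst z = c + snd z * m} = {z. (1, - m) \<bullet> z = c}"
      by (auto simp: inner_prod_def)
    then show ?thesis by (simp add: negligible_hyperplane zero_prod_def)
  qed
  have hyp2: "negligible {z :: real \<times> real. snd z = c}" for c
  proof -
    have "{z :: real \<times> real. snd z = c} = {z. (0, 1) \<bullet> z = c}"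
      by (auto simp: inner_prod_def)
    then show ?thesis by (simp add: negligible_hyperplane zero_prod_def)
  qed
  have "negligible {z :: real \<times> real. fst z = diagonal i j (snd z)}" for i j
    using hyp[of "diagonal_bot i j - y j * diagonal_slope i j" "diagonal_slope i j"]
    by (rule negligible_subset) (auto simp: diagonal_def algebra_simps)
  then show "negligible ((\<Union>i<n. {z :: real \<times> real. fst z = x i}) \<union> (\<Union>j<n. {z. snd z = y j}) \<union>
      (\<Union>i<n - 1. \<Union>j<n - 1. {z. fst z = diagonal i j (snd z)}))"
    using hyp[of _ 0] hyp2 by (auto intro!: negligible_Un negligible_Union)
  show "skeleton \<subseteq> (\<Union>i<n. {z. fst z = x i}) \<union> (\<Union>j<n. {z. snd z = y j}) \<union>
      (\<Union>i<n - 1. \<Union>j<n - 1. {z. fst z = diagonal i j (snd z)})"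
    using skeleton_subset by fastforce
qed

lemma AE_open_triangles: "AE z in lebesgue_on (square L). z \<in> \<Union>(open_triangle ` indices)"
proof -
  have "AE z in lebesgue. z \<notin> skeleton"
    using negligible_skeleton by (intro AE_not_in) (simp add: negligible_iff_null_sets)
  then show ?thesis
    using open_square by (subst AE_restrict_space_iff) (auto elim!: AE_mp)
qed

text \<open>This inclusion suffices to pass affinity from the hulls, where \<open>X_N\<close>
  prescribes it, to the triangles given by inequalities.\<close>

lemma closed_triangle_subset_triangles:
  assumes "k \<in> indices"
  shows "\<exists>K\<in>triangles. closed_triangle k \<subseteq> K"
proof -
  obtain i j r where k: "k = (i, j, r)" "i < n - 1" "j < n - 1"
    using assms by (auto simp: indices_def)
  define D E where "D = x (Suc i) - x i" and "E = y (Suc j) - y j"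
  have DE: "D > 0" "E > 0" using x_step[OF k(2)] y_step[OF k(3)] by (auto simp: D_def E_def)
  have x1: "x (Suc i) = x i + D" and y1: "y (Suc j) = y j + E" by (auto simp: D_def E_def)
  let ?ll = "(x i, y j)" and ?lr = "(x i + D, y j)" and ?ul = "(x i, y j + E)" and ?ur = "(x i + D, y j + E)"
  have hull: "z \<in> convex hull {p, q, w}"
    if "0 \<le> a" "0 \<le> b" "0 \<le> c" "a + b + c = 1" "z = a *\<^sub>R p + b *\<^sub>R q + c *\<^sub>R w"
    for a b c and z p q w :: "real \<times> real"
    using that unfolding convex_hull_3 by blast
  define K where "K = (if d i j then if r then convex hull {?ll, ?lr, ?ur} else convex hull {?ll, ?ul, ?ur}
     else if r then convex hull {?lr, ?ul, ?ur} else convex hull {?ll, ?lr, ?ul})"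
  have "K \<in> cell_triangles x y (d i j) i j"
    unfolding cell_triangles_def Let_def K_def x1 y1 by auto
  then have "K \<in> triangles" using k by (auto simp: triangles_def)
  moreover have "z \<in> K" if "z \<in> closed_triangle k" for z
  proof -
    \<comment> \<open>In coordinates scaled to the unit square the diagonal reads \<alpha> = \<beta>
      or \<alpha> = 1 - \<beta>, and the barycentric weights in each of the four cases are affine in
      \<alpha> and \<beta>.\<close>
    define \<alpha> \<beta> where "\<alpha> = (fst z - x i) / D" and "\<beta> = (snd z - y j) / E"
    have z: "fst z = x i + \<alpha> * D" "snd z = y j + \<beta> * E"
      using DE by (simp_all add: \<alpha>_def \<beta>_def)
    have ab: "0 \<le> \<alpha>" "\<alpha> \<le> 1" "0 \<le> \<beta>" "\<beta> \<le> 1"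
      using that DE by (auto simp: closed_triangle_def k \<alpha>_def \<beta>_def x1 y1)
    have slope: "diagonal_slope i j = (if d i j then D / E else - (D / E))"
      by (simp add: diagonal_slope_def diagonal_bot_def diagonal_top_def D_def E_def minus_divide_left)
    have diag: "diagonal i j (snd z) = (if d i j then x i + \<beta> * D else x i + (1 - \<beta>) * D)"
      by (simp add: diagonal_def diagonal_bot_def slope \<beta>_def x1 algebra_simps
          add_divide_distrib diff_divide_distrib)
    have side: "if r then diagonal i j (snd z) \<le> fst z else fst z \<le> diagonal i j (snd z)"
      using that by (cases r) (simp_all add: closed_triangle_def k case_prod_unfold)
    show ?thesis
    proof (cases "d i j")
      case True
      show ?thesis
      proof (cases r)
        case r: True
        have "\<beta> \<le> \<alpha>" using side True r DE unfolding diag z(1) by simp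
        then have "z \<in> convex hull {?ll, ?lr, ?ur}"
          using ab by (intro hull[of "1 - \<alpha>" "\<alpha> - \<beta>" \<beta>]) (simp_all add: z prod_eq_iff algebra_simps)
        with True r show ?thesis by (simp add: K_def)
      next
        case r: False
        have "\<alpha> \<le> \<beta>" using side True r DE unfolding diag z(1) by simp
        then have "z \<in> convex hull {?ll, ?ul, ?ur}"
          using ab by (intro hull[of "1 - \<beta>" "\<beta> - \<alpha>" \<alpha>]) (simp_all add: z prod_eq_iff algebra_simps)
        with True r show ?thesis by (simp add: K_def)
      qed
    next
      case False
      show ?thesis
      proof (cases r)
        case r: True
        have "1 - \<beta> \<le> \<alpha>" using side False r DE unfolding diag z(1)
          by (simp flip: distrib_right)
        then have "z \<in> convex hull {?lr, ?ul, ?ur}"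
          using ab by (intro hull[of "1 - \<beta>" "1 - \<alpha>" "\<alpha> + \<beta> - 1"]) (simp_all add: z prod_eq_iff algebra_simps)
        with False r show ?thesis by (simp add: K_def)
      next
        case r: False
        have "\<alpha> \<le> 1 - \<beta>" using side False r DE unfolding diag z(1)
          by (simp flip: distrib_right)
        then have "z \<in> convex hull {?ll, ?lr, ?ul}"
          using ab by (intro hull[of "1 - \<alpha> - \<beta>" \<alpha> \<beta>]) (simp_all add: z prod_eq_iff algebra_simps)
        with False r show ?thesis by (simp add: K_def)
      qed
    qed
  qed
  ultimately show ?thesis by blast
qed

lemma X_N_affine:
  assumes "v \<in> X_N L triangles" "k \<in> indices"
  obtains a b c where "\<And>s t. (s, t) \<in> closed_triangle k \<Longrightarrow> v (s, t) = a + b * s + c * t"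
proof -
  obtain K where K: "K \<in> triangles" "closed_triangle k \<subseteq> K"
    using closed_triangle_subset_triangles[OF assms(2)] by blast
  have "\<exists>a b c. \<forall>(s, t)\<in>K. v (s, t) = a + b * s + c * t"
    using assms(1) K(1) by (simp add: X_N_def)
  then obtain a b c where abc: "\<forall>(s, t)\<in>K. v (s, t) = a + b * s + c * t"
    by (elim exE) (rule that)
  have "v (s, t) = a + b * s + c * t" if "(s, t) \<in> closed_triangle k" for s t
    using bspec[OF abc subsetD[OF K(2) that]] by simp
  then show ?thesis by (rule that)
qed

end

section \<open>Weak gradients of piecewise affine functions\<close>

text \<open>Completeness of Lebesgue measure. It transfers measurability from explicit
  representatives to the chosen weak derivatives.\<close>

lemma borel_measurable_lebesgue_on_AE:
  fixes f g :: "'a::euclidean_space \<Rightarrow> real"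
  assumes S: "S \<in> sets lebesgue" and f: "f \<in> borel_measurable (lebesgue_on S)"
    and ae: "AE z in lebesgue_on S. f z = g z"
  shows "g \<in> borel_measurable (lebesgue_on S)"
proof -
  have "(\<lambda>z. if z \<in> S then f z else 0) \<in> borel_measurable lebesgue"
    using f S by (simp add: borel_measurable_if)
  moreover have "AE z in lebesgue. (if z \<in> S then f z else 0) = (if z \<in> S then g z else 0)"
    using ae S by (subst (asm) AE_restrict_space_iff) (auto elim!: AE_mp)
  ultimately have "(\<lambda>z. if z \<in> S then g z else 0) \<in> borel_measurable lebesgue"
    by (rule borel_measurable_AE)
  then show ?thesis using S by (simp add: borel_measurable_if)
qed

lemma integral_open_interval_FTC:
  fixes F f :: "real \<Rightarrow> real"
  assumes "a \<le> b" and cont: "continuous_on {a..b} f"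
    and F: "\<And>t. t \<in> {a..b} \<Longrightarrow> (F has_real_derivative f t) (at t)"
  shows "(LINT t|lborel. indicator {a<..<b} t * f t) = F b - F a"
proof -
  have vd: "(F has_vector_derivative f t) (at t within {a..b})" if "a \<le> t" "t \<le> b" for t
    using F[of t] that
    by (simp add: has_real_derivative_iff_has_vector_derivative has_vector_derivative_at_within)
  have "(LBINT t=a..b. f t) = F b - F a"
    using \<open>a \<le> b\<close> cont vd by (intro interval_integral_FTC_finite) simp_all
  then show ?thesis
    using assms by (simp add: interval_integral_Ioo set_lebesgue_integral_def)
qed

text \<open>Integration by parts on a line: the integrand is the derivative of \<open>v * w\<close>
  off a finite set, \<open>v * w\<close> is continuous across that set, and it vanishes at both
  ends.\<close>

lemma integral_product_derivative_zero:
  fixes v g w w' :: "real \<Rightarrow> real"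
  assumes "0 < L" and S: "finite S"
    and v: "continuous_on {0..L} v" "\<And>s. s \<in> {0<..<L} - S \<Longrightarrow> (v has_real_derivative g s) (at s)"
    and w: "\<And>s. (w has_real_derivative w' s) (at s)" "w 0 = 0" "w L = 0"
    and int: "integrable lborel (\<lambda>s. indicator {0<..<L} s * (g s * w s + v s * w' s))"
  shows "(LINT s|lborel. indicator {0<..<L} s * (g s * w s + v s * w' s)) = 0"
proof -
  let ?f = "\<lambda>s. g s * w s + v s * w' s"
  have "continuous_on {0..L} w"
    using w(1) by (meson DERIV_isCont continuous_at_imp_continuous_on)
  then have "(?f has_integral (v L * w L - v 0 * w 0)) {0..L}"
    using v w S \<open>0 < L\<close>
    by (intro fundamental_theorem_of_calculus_interior_strong[of S])
      (auto intro!: continuous_intros derivative_eq_intros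
        simp flip: has_real_derivative_iff_has_vector_derivative)
  then have "(?f has_integral 0) {0<..<L}"
    using w by (simp add: has_integral_Icc_iff_Ioo)
  then have "((\<lambda>s. indicator {0<..<L} s * ?f s) has_integral 0) UNIV"
    by (subst (asm) has_integral_restrict_UNIV[symmetric])
      (auto elim!: has_integral_eq[rotated] simp: indicator_def)
  \<comment> \<open>The fundamental theorem yields a gauge integral; the integrability hypothesis
    identifies it with the Lebesgue integral.\<close>
  with has_integral_integral_lborel[OF int] show ?thesis
    by (rule has_integral_unique)
qed

text \<open>A row integral of an affine function is the row length times the value at the midpoint
  of the row. Allowing both sides to slope makes triangles on either side of a diagonal, whichever
  way it runs, instances of one formula.\<close>

lemma trapezoid_integral:
  fixes A B C a b l0 l1 r0 r1 :: real
  defines "T \<equiv> {z. a < snd z \<and> snd z < b \<and> l0 + (snd z - a) * l1 < fst z \<and> fst z < r0 + (snd z - a) * r1}"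
  assumes "a < b" and le: "\<And>t. a < t \<Longrightarrow> t < b \<Longrightarrow> l0 + (t - a) * l1 \<le> r0 + (t - a) * r1"
    and int: "integrable lborel (\<lambda>z. indicator T z * (A + B * fst z + C * snd z))"
  shows "(LINT z|lborel. indicator T z * (A + B * fst z + C * snd z)) =
    (b - a) * ((r0 - l0) * (A + C * a + B * ((l0 + r0) / 2)) +
      ((r0 - l0) * (C + B * ((l1 + r1) / 2)) + (r1 - l1) * (A + C * a + B * ((l0 + r0) / 2))) * (b - a) / 2 +
      (r1 - l1) * (C + B * ((l1 + r1) / 2)) * (b - a)\<^sup>2 / 3)"
proof -
  \<comment> \<open>Row length and midpoint value are affine in \<open>t - a\<close>; these are the
    coefficients of their product.\<close>
  define q0 q1 q2 where "q0 = (r0 - l0) * (A + C * a + B * ((l0 + r0) / 2))"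
    and "q1 = (r0 - l0) * (C + B * ((l1 + r1) / 2)) + (r1 - l1) * (A + C * a + B * ((l0 + r0) / 2))"
    and "q2 = (r1 - l1) * (C + B * ((l1 + r1) / 2))"
  have inner: "(LINT s|lborel. indicator T (s, t) * (A + B * s + C * t)) =
      indicator {a<..<b} t * (q0 + q1 * (t - a) + q2 * (t - a)\<^sup>2)" for t
  proof (cases "t \<in> {a<..<b}")
    case True
    let ?l = "l0 + (t - a) * l1" and ?r = "r0 + (t - a) * r1"
    have "(LINT s|lborel. indicator T (s, t) * (A + B * s + C * t)) =
        (LINT s|lborel. indicator {?l<..<?r} s * (A + B * s + C * t))"
      using True by (intro Bochner_Integration.integral_cong) (auto simp: T_def indicator_def)
    also have "\<dots> = (A * ?r + B * ?r\<^sup>2 / 2 + C * t * ?r) - (A * ?l + B * ?l\<^sup>2 / 2 + C * t * ?l)"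
      using le True by (intro integral_open_interval_FTC)
        (auto intro!: continuous_intros derivative_eq_intros)
    also have "\<dots> = q0 + q1 * (t - a) + q2 * (t - a)\<^sup>2"
      unfolding q0_def q1_def q2_def by (simp add: field_simps power2_eq_square)
    finally show ?thesis using True by simp
  qed (auto simp: T_def)
  have "(LINT z|lborel. indicator T z * (A + B * fst z + C * snd z)) =
      (LINT t|lborel. LINT s|lborel. indicator T (s, t) * (A + B * s + C * t))"
    using lborel_pair.integral_snd[of "\<lambda>s t. indicator T (s, t) * (A + B * s + C * t)"] int
    by (simp add: lborel_prod case_prod_unfold)
  also have "\<dots> = (LINT t|lborel. indicator {a<..<b} t * (q0 + q1 * (t - a) + q2 * (t - a)\<^sup>2))"
    by (simp add: inner)
  also have "\<dots> = (q0 * (b - a) + q1 * (b - a)\<^sup>2 / 2 + q2 * (b - a) ^ 3 / 3) -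
      (q0 * (a - a) + q1 * (a - a)\<^sup>2 / 2 + q2 * (a - a) ^ 3 / 3)"
    using \<open>a < b\<close> by (intro integral_open_interval_FTC)
      (auto intro!: continuous_intros derivative_eq_intros)
  also have "\<dots> = (b - a) * (q0 + q1 * (b - a) / 2 + q2 * (b - a)\<^sup>2 / 3)"
    by (simp add: distrib_left power2_eq_square power3_eq_cube mult.left_commute)
  finally show ?thesis
    unfolding q0_def q1_def q2_def .
qed

section \<open>Test functions along coordinate lines\<close>

lemma test_functionsD:
  assumes "\<zeta> \<in> test_functions \<Omega>"
  shows "\<zeta> differentiable (at z)" "continuous_on UNIV \<zeta>"
    "e \<in> Basis \<Longrightarrow> continuous_on UNIV (\<lambda>z. frechet_derivative \<zeta> (at z) e)"
    "z \<notin> \<Omega> \<Longrightarrow> \<zeta> z = 0"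
proof -
  have "C_k 0 \<zeta>" "C_k (Suc 0) \<zeta>" using assms unfolding test_functions_def by blast+
  then show "\<zeta> differentiable (at z)" "continuous_on UNIV \<zeta>"
    "e \<in> Basis \<Longrightarrow> continuous_on UNIV (\<lambda>z. frechet_derivative \<zeta> (at z) e)"
    unfolding C_k.simps by blast+
  show "\<zeta> z = 0" if "z \<notin> \<Omega>"
    using assms that closure_subset[of "{z. \<zeta> z \<noteq> 0}"] unfolding test_functions_def by blast
qed

lemma test_function_derivative_fst:
  assumes "\<zeta> \<in> test_functions \<Omega>"
  shows "((\<lambda>s. \<zeta> (s, t)) has_real_derivative frechet_derivative \<zeta> (at (s, t)) (1, 0)) (at s)"
proof -
  let ?D = "frechet_derivative \<zeta> (at (s, t))"
  have D: "(\<zeta> has_derivative ?D) (at (s, t))"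
    using test_functionsD(1)[OF assms] frechet_derivative_works by blast
  have "((\<lambda>s. (s, t)) has_derivative (\<lambda>h. (h, 0))) (at s)"
    by (auto intro!: derivative_eq_intros)
  then have "((\<lambda>s. \<zeta> (s, t)) has_derivative (\<lambda>h. ?D (h, 0))) (at s)"
    using D by (rule has_derivative_compose)
  moreover have "(\<lambda>h. ?D (h, 0)) = (\<lambda>h. ?D (1, 0) * h)"
  proof
    fix h
    show "?D (h, 0) = ?D (1, 0) * h"
      using linear_scale[OF has_derivative_linear[OF D], of h "(1, 0)"] by simp
  qed
  ultimately show ?thesis by (simp only: has_field_derivative_def)
qed

lemma test_function_derivative_snd:
  assumes "\<zeta> \<in> test_functions \<Omega>"
  shows "((\<lambda>t. \<zeta> (s, t)) has_real_derivative frechet_derivative \<zeta> (at (s, t)) (0, 1)) (at t)"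
proof -
  let ?D = "frechet_derivative \<zeta> (at (s, t))"
  have D: "(\<zeta> has_derivative ?D) (at (s, t))"
    using test_functionsD(1)[OF assms] frechet_derivative_works by blast
  have "((\<lambda>t. (s, t)) has_derivative (\<lambda>h. (0, h))) (at t)"
    by (auto intro!: derivative_eq_intros)
  then have "((\<lambda>t. \<zeta> (s, t)) has_derivative (\<lambda>h. ?D (0, h))) (at t)"
    using D by (rule has_derivative_compose)
  moreover have "(\<lambda>h. ?D (0, h)) = (\<lambda>h. ?D (0, 1) * h)"
  proof
    fix h
    show "?D (0, h) = ?D (0, 1) * h"
      using linear_scale[OF has_derivative_linear[OF D], of h "(0, 1)"] by simp
  qed
  ultimately show ?thesis by (simp only: has_field_derivative_def)
qed

section \<open>Functions given triangle by triangle, their integrals and weak partial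
  derivatives\<close>

context square_triangulation
begin

text \<open>An extension continuous on the whole plane keeps each piece bounded on its triangle,
  hence integrable; values on the edges are left free.\<close>

definition piecewise_continuous :: "(real \<times> real \<Rightarrow> real) \<Rightarrow> bool" where
  "piecewise_continuous f \<longleftrightarrow>
     (\<forall>k\<in>indices. \<exists>c. continuous_on UNIV c \<and> (\<forall>z\<in>open_triangle k. f z = c z))"

definition piecewise :: "(nat \<times> nat \<times> bool \<Rightarrow> real \<times> real \<Rightarrow> real) \<Rightarrow> real \<times> real \<Rightarrow> real" where
  "piecewise c z = (\<Sum>k\<in>indices. indicator (open_triangle k) z * c k z)"

lemma piecewise_eq:
  assumes "k \<in> indices" "z \<in> open_triangle k"
  shows "piecewise c z = c k z"
proof -
  have "indicator (open_triangle l) z * c l z = (if l = k then c k z else 0)" if "l \<in> indices" for l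
  proof (cases "l = k")
    case False
    then have "z \<notin> open_triangle l" using open_triangle_unique[OF that assms(1) _ assms(2)] by blast
    with False show ?thesis by simp
  qed (use assms in simp)
  then have "piecewise c z = (\<Sum>l\<in>indices. if l = k then c k z else 0)"
    unfolding piecewise_def by (intro sum.cong) auto
  with assms finite_indices show ?thesis by simp
qed

lemma integrable_on_triangle:
  fixes c :: "real \<times> real \<Rightarrow> real"
  assumes "continuous_on UNIV c" "k \<in> indices"
  shows "integrable lborel (\<lambda>z. indicator (open_triangle k) z * c z)"
proof -
  have "compact (closure (square L))"
    using bounded_square by (simp add: compact_closure)
  then have "integrable lborel (\<lambda>z. indicator (closure (square L)) z *\<^sub>R c z)"
    by (rule borel_integrable_compact[OF _ continuous_on_subset[OF assms(1)]]) auto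
  then have "integrable lborel (\<lambda>z. indicator (open_triangle k) z *\<^sub>R indicator (closure (square L)) z *\<^sub>R c z)"
    by (rule integrable_mult_indicator[rotated]) (simp add: open_open_triangle borel_open)
  moreover have "indicator (open_triangle k) z *\<^sub>R indicator (closure (square L)) z *\<^sub>R c z =
      indicator (open_triangle k) z * c z" for z
    using open_triangle_subset_square[OF assms(2)] closure_subset by (auto simp: indicator_def)
  ultimately show ?thesis by (simp only:)
qed

text \<open>The edges are negligible, so \<open>f\<close> agrees almost everywhere with the Borel
  function \<open>piecewise c\<close>, whose integral splits over the triangles.\<close>

lemma integral_piecewise:
  fixes c :: "nat \<times> nat \<times> bool \<Rightarrow> real \<times> real \<Rightarrow> real"
  assumes c: "\<And>k. k \<in> indices \<Longrightarrow> continuous_on UNIV (c k)"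
    and f: "\<And>k z. k \<in> indices \<Longrightarrow> z \<in> open_triangle k \<Longrightarrow> f z = c k z"
  shows "integrable (lebesgue_on (square L)) f"
    and "(LINT z|lebesgue_on (square L). f z) =
      (\<Sum>k\<in>indices. LINT z|lborel. indicator (open_triangle k) z * c k z)"
proof -
  have int: "integrable lborel (piecewise c)"
    unfolding piecewise_def using c by (intro Bochner_Integration.integrable_sum integrable_on_triangle)
  have sq: "indicator (square L) z *\<^sub>R piecewise c z = piecewise c z" for z
  proof (cases "z \<in> square L")
    case False
    then have "indicator (open_triangle k) z * c k z = 0" if "k \<in> indices" for k
      using open_triangle_subset_square[OF that] by (auto simp: indicator_def)
    with False show ?thesis by (simp add: piecewise_def sum.neutral)
  qed simp
  have pint: "integrable (lebesgue_on (square L)) (piecewise c)"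
  proof (subst integrable_restrict_space)
    show "integrable lebesgue (\<lambda>z. indicator (square L) z *\<^sub>R piecewise c z)"
      unfolding sq using int by (simp add: integrable_completion)
  qed (use open_square in auto)
  have ae: "AE z in lebesgue_on (square L). piecewise c z = f z"
    using AE_open_triangles by eventually_elim (auto simp: piecewise_eq f)
  have meas: "f \<in> borel_measurable (lebesgue_on (square L))"
    using borel_measurable_lebesgue_on_AE[OF _ borel_measurable_integrable[OF pint] ae] open_square by simp
  show "integrable (lebesgue_on (square L)) f"
    using integrable_cong_AE_imp[OF pint meas ae] .
  have "(LINT z|lebesgue_on (square L). f z) = (LINT z|lebesgue_on (square L). piecewise c z)"
    using ae pint meas by (intro integral_cong_AE) auto
  also have "\<dots> = (LINT z|lebesgue. piecewise c z)"
    using open_square by (subst integral_restrict_space) (simp_all only: sq, auto)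
  also have "\<dots> = (LINT z|lborel. piecewise c z)"
    using int by (intro integral_completion) auto
  also have "\<dots> = (\<Sum>k\<in>indices. LINT z|lborel. indicator (open_triangle k) z * c k z)"
    unfolding piecewise_def using c by (intro Bochner_Integration.integral_sum integrable_on_triangle)
  finally show "(LINT z|lebesgue_on (square L). f z) =
      (\<Sum>k\<in>indices. LINT z|lborel. indicator (open_triangle k) z * c k z)" .
qed

lemma piecewise_continuous_integrable:
  assumes "piecewise_continuous f"
  shows "integrable (lebesgue_on (square L)) f"
proof -
  from bchoice[OF assms[unfolded piecewise_continuous_def]] obtain c
    where c: "\<forall>k\<in>indices. continuous_on UNIV (c k) \<and> (\<forall>z\<in>open_triangle k. f z = c k z)" ..
  show ?thesis by (rule integral_piecewise(1)[of c]) (use c in auto)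
qed

lemma piecewise_continuous_locally_integrable:
  assumes "piecewise_continuous f"
  shows "locally_integrable (square L) f"
proof -
  have "set_integrable lebesgue (square L) f"
    using piecewise_continuous_integrable[OF assms] open_square
    by (subst (asm) integrable_restrict_space) (auto simp: set_integrable_def)
  then show ?thesis
    unfolding locally_integrable_def
    by (auto intro!: set_integrable_subset[of lebesgue "square L"] simp: compact_imp_closed)
qed

lemma piecewise_continuous_mult:
  "piecewise_continuous f \<Longrightarrow> piecewise_continuous g \<Longrightarrow> piecewise_continuous (\<lambda>z. f z * g z)"
  unfolding piecewise_continuous_def
proof
  fix k assume k: "k \<in> indices"
  assume f: "\<forall>k\<in>indices. \<exists>c. continuous_on UNIV c \<and> (\<forall>z\<in>open_triangle k. f z = c z)"
    and g: "\<forall>k\<in>indices. \<exists>c. continuous_on UNIV c \<and> (\<forall>z\<in>open_triangle k. g z = c z)"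
  from f k obtain c where c: "continuous_on UNIV c" "\<forall>z\<in>open_triangle k. f z = c z" by blast
  from g k obtain e where e: "continuous_on UNIV e" "\<forall>z\<in>open_triangle k. g z = e z" by blast
  from c e show "\<exists>c. continuous_on UNIV c \<and> (\<forall>z\<in>open_triangle k. f z * g z = c z)"
    by (intro exI[of _ "\<lambda>z. c z * e z"] conjI continuous_on_mult) simp_all
qed

lemma continuous_imp_piecewise_continuous:
  "continuous_on UNIV f \<Longrightarrow> piecewise_continuous f"
  unfolding piecewise_continuous_def by blast

lemma piecewise_const_continuous: "piecewise_continuous (piecewise (\<lambda>k _. b k))"
  unfolding piecewise_continuous_def
  by (intro ballI exI[where x = "\<lambda>_. b _"] conjI) (auto simp: piecewise_eq)

lemma piecewise_affine_continuous:
  assumes "\<And>k s t. k \<in> indices \<Longrightarrow> (s, t) \<in> open_triangle k \<Longrightarrow> u (s, t) = a k + b k * s + c k * t"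
  shows "piecewise_continuous u"
  unfolding piecewise_continuous_def
proof
  fix k assume k: "k \<in> indices"
  have "u z = a k + b k * fst z + c k * snd z" if "z \<in> open_triangle k" for z
    using assms[OF k, of "fst z" "snd z"] that by simp
  then show "\<exists>f. continuous_on UNIV f \<and> (\<forall>z\<in>open_triangle k. u z = f z)"
    by (intro exI[of _ "\<lambda>z. a k + b k * fst z + c k * snd z"]) (auto intro!: continuous_intros)
qed

text \<open>Recasts the definition as the vanishing of a single Borel integral over the plane, with
  its integrability granted, which is the form that Fubini consumes.\<close>

lemma has_weak_partial_if_integral_zero:
  assumes u: "continuous_on (square L) u" "piecewise_continuous u"
    and g: "piecewise_continuous g" "g \<in> borel_measurable borel"
    and e: "e \<in> Basis"
    and zero: "\<And>\<zeta>. \<zeta> \<in> test_functions (square L) \<Longrightarrow>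
      integrable lborel (\<lambda>z. indicator (square L) z *
         (g z * \<zeta> z + u z * frechet_derivative \<zeta> (at z) e)) \<Longrightarrow>
      (LINT z|lborel. indicator (square L) z * (g z * \<zeta> z + u z * frechet_derivative \<zeta> (at z) e)) = 0"
  shows "has_weak_partial (square L) u e g"
  unfolding has_weak_partial_def
proof (intro conjI ballI)
  show "locally_integrable (square L) u" "locally_integrable (square L) g"
    using u g by (auto intro: piecewise_continuous_locally_integrable)
  fix \<zeta> assume \<zeta>: "\<zeta> \<in> test_functions (square L)"
  let ?D = "\<lambda>z. frechet_derivative \<zeta> (at z) e"
  let ?f = "\<lambda>z. g z * \<zeta> z + u z * ?D z"
  have pc: "piecewise_continuous (\<lambda>z. g z * \<zeta> z)" "piecewise_continuous (\<lambda>z. u z * ?D z)"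
    using piecewise_continuous_mult[OF g(1) continuous_imp_piecewise_continuous[OF test_functionsD(2)[OF \<zeta>]]]
      piecewise_continuous_mult[OF u(2) continuous_imp_piecewise_continuous[OF test_functionsD(3)[OF \<zeta> e]]]
    by auto
  note int = pc[THEN piecewise_continuous_integrable]
  have "integrable (lebesgue_on (square L)) ?f"
    using int by simp
  then have leb: "integrable lebesgue (\<lambda>z. indicator (square L) z * ?f z)"
    using open_square by (subst (asm) integrable_restrict_space) auto
  \<comment> \<open>Nothing is known about \<open>u\<close> outside the square, so the indicator is
    attached to \<open>u\<close> itself to get a Borel function.\<close>
  have "(\<lambda>z. indicator (square L) z *\<^sub>R u z) \<in> borel_measurable borel"
    using u open_square by (intro borel_measurable_continuous_on_indicator) auto
  then have "(\<lambda>z. indicator (square L) z * (g z * \<zeta> z) + (indicator (square L) z *\<^sub>R u z) * ?D z) \<in> borel_measurable borel"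
    using g(2) open_square borel_measurable_continuous_onI[OF test_functionsD(2)[OF \<zeta>]]
      borel_measurable_continuous_onI[OF test_functionsD(3)[OF \<zeta> e]]
    by (intro borel_measurable_add borel_measurable_times borel_measurable_indicator borel_open)
  then have meas: "(\<lambda>z. indicator (square L) z * ?f z) \<in> borel_measurable lborel"
    by (simp add: algebra_simps)
  have "(LINT z|lebesgue_on (square L). ?f z) = (LINT z|lebesgue. indicator (square L) z * ?f z)"
    using open_square by (subst integral_restrict_space) auto
  also have "\<dots> = (LINT z|lborel. indicator (square L) z * ?f z)"
    using meas by (rule integral_completion)
  also have "\<dots> = 0"
    using leb meas by (intro zero \<zeta>) (simp add: integrable_completion)
  finally show "(LINT z|lebesgue_on (square L). u z * ?D z) = - (LINT z|lebesgue_on (square L). g z * \<zeta> z)"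
    using int by simp
qed

lemma piecewise_const_borel: "piecewise (\<lambda>k _. b k) \<in> borel_measurable borel"
  unfolding piecewise_def
  by (intro borel_measurable_sum borel_measurable_times borel_measurable_indicator)
    (auto simp: open_open_triangle borel_open)

text \<open>Along almost every row, \<open>u\<close> is continuous and affine between finitely many
  edge crossings, and the test function vanishes at the ends. Integration by parts therefore holds
  row by row, and Fubini assembles the rows.\<close>

lemma piecewise_affine_has_weak_dx:
  assumes u: "continuous_on (closed_square L) u"
    and aff: "\<And>k s t. k \<in> indices \<Longrightarrow> (s, t) \<in> open_triangle k \<Longrightarrow> u (s, t) = a k + b k * s + c k * t"
  shows "has_weak_partial (square L) u (1, 0) (piecewise (\<lambda>k _. b k))"
proof (rule has_weak_partial_if_integral_zero)
  show "continuous_on (square L) u"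
    using u by (rule continuous_on_subset) (auto simp: square_def closed_square_def)
  show "piecewise_continuous u" using aff by (rule piecewise_affine_continuous)
  show "(1, 0) \<in> (Basis :: (real \<times> real) set)" by (simp add: Basis_prod_def)
  fix \<zeta> assume \<zeta>: "\<zeta> \<in> test_functions (square L)"
  let ?g = "piecewise (\<lambda>k _. b k)"
  let ?h = "\<lambda>s t. indicator (square L) (s, t) *
      (?g (s, t) * \<zeta> (s, t) + u (s, t) * frechet_derivative \<zeta> (at (s, t)) (1, 0))"
  assume "integrable lborel (\<lambda>z. indicator (square L) z *
      (?g z * \<zeta> z + u z * frechet_derivative \<zeta> (at z) (1, 0)))"
  then have int: "integrable (lborel \<Otimes>\<^sub>M lborel) (case_prod ?h)"
    by (simp add: lborel_prod case_prod_unfold)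
  have row: "(LINT s|lborel. ?h s t) = 0"
    if int: "integrable lborel (\<lambda>s. ?h s t)" and t: "t \<notin> y ` {..<n}" for t
  proof (cases "t \<in> {0<..<L}")
    case True
    then have ind: "indicator (square L) (s, t) = (indicator {0<..<L} s :: real)" for s
      by (auto simp: square_def indicator_def)
    have der: "((\<lambda>s. u (s, t)) has_real_derivative ?g (s, t)) (at s)"
      if "s \<in> {0<..<L} - {s. (s, t) \<in> skeleton}" for s
    proof -
      have "(s, t) \<in> \<Union>(open_triangle ` indices)"
        using that True by (auto simp: square_def)
      then obtain k where k: "k \<in> indices" "(s, t) \<in> open_triangle k"
        by blast
      have "((\<lambda>s. a k + b k * s + c k * t) has_real_derivative b k) (at s)"
        by (auto intro!: derivative_eq_intros)
      moreover have "open ((\<lambda>s. (s, t)) -` open_triangle k)"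
        using open_open_triangle by (intro open_vimage) (auto intro!: continuous_intros)
      ultimately have "((\<lambda>s. u (s, t)) has_real_derivative b k) (at s)"
      proof (rule has_field_derivative_transform_within_open)
        show "s \<in> (\<lambda>s. (s, t)) -` open_triangle k" using k(2) by simp
        show "a k + b k * r + c k * t = u (r, t)" if "r \<in> (\<lambda>s. (s, t)) -` open_triangle k" for r
          using aff[OF k(1), of r t] that by simp
      qed
      with k show ?thesis by (simp add: piecewise_eq)
    qed
    show ?thesis
      unfolding ind
    proof (rule integral_product_derivative_zero[OF L_pos finite_skeleton_row[OF t] _ der
          test_function_derivative_fst[OF \<zeta>]])
      show "continuous_on {0..L} (\<lambda>s. u (s, t))"
        using True by (intro continuous_on_compose2[OF u]) (auto intro!: continuous_intros simp: closed_square_def)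
      show "\<zeta> (0, t) = 0" "\<zeta> (L, t) = 0"
        using test_functionsD(4)[OF \<zeta>] by (auto simp: square_def)
    qed (use int in \<open>simp_all only: ind\<close>)
  qed (auto simp: square_def)
  \<comment> \<open>At a node height the row may run inside an edge. There are finitely many such
    heights.\<close>
  have "AE t in lborel. t \<notin> y ` {..<n}"
    by (intro AE_not_in countable_imp_null_set_lborel countable_finite) auto
  with lborel_pair.AE_integrable_snd[OF int] have "AE t in lborel. (LINT s|lborel. ?h s t) = 0"
    by eventually_elim (rule row)
  then have "(LINT t|lborel. LINT s|lborel. ?h s t) = 0"
    by (rule integral_eq_zero_AE)
  then show "(LINT z|lborel. indicator (square L) z *
      (?g z * \<zeta> z + u z * frechet_derivative \<zeta> (at z) (1, 0))) = 0"
    unfolding lborel_pair.integral_snd[OF int] by (simp add: lborel_prod case_prod_unfold)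
qed (auto simp: piecewise_const_continuous piecewise_const_borel)

text \<open>The same argument along columns, with Fubini in the other order.\<close>

lemma piecewise_affine_has_weak_dy:
  assumes u: "continuous_on (closed_square L) u"
    and aff: "\<And>k s t. k \<in> indices \<Longrightarrow> (s, t) \<in> open_triangle k \<Longrightarrow> u (s, t) = a k + b k * s + c k * t"
  shows "has_weak_partial (square L) u (0, 1) (piecewise (\<lambda>k _. c k))"
proof (rule has_weak_partial_if_integral_zero)
  show "continuous_on (square L) u"
    using u by (rule continuous_on_subset) (auto simp: square_def closed_square_def)
  show "piecewise_continuous u" using aff by (rule piecewise_affine_continuous)
  show "(0, 1) \<in> (Basis :: (real \<times> real) set)" by (simp add: Basis_prod_def)
  fix \<zeta> assume \<zeta>: "\<zeta> \<in> test_functions (square L)"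
  let ?g = "piecewise (\<lambda>k _. c k)"
  let ?h = "\<lambda>s t. indicator (square L) (s, t) *
      (?g (s, t) * \<zeta> (s, t) + u (s, t) * frechet_derivative \<zeta> (at (s, t)) (0, 1))"
  assume "integrable lborel (\<lambda>z. indicator (square L) z *
      (?g z * \<zeta> z + u z * frechet_derivative \<zeta> (at z) (0, 1)))"
  then have int: "integrable (lborel \<Otimes>\<^sub>M lborel) (case_prod ?h)"
    by (simp add: lborel_prod case_prod_unfold)
  have column: "(LINT t|lborel. ?h s t) = 0"
    if int: "integrable lborel (\<lambda>t. ?h s t)" and s: "s \<notin> x ` {..<n}" for s
  proof (cases "s \<in> {0<..<L}")
    case True
    then have ind: "indicator (square L) (s, t) = (indicator {0<..<L} t :: real)" for t
      by (auto simp: square_def indicator_def)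
    have der: "((\<lambda>t. u (s, t)) has_real_derivative ?g (s, t)) (at t)"
      if "t \<in> {0<..<L} - {t. (s, t) \<in> skeleton}" for t
    proof -
      have "(s, t) \<in> \<Union>(open_triangle ` indices)"
        using that True by (auto simp: square_def)
      then obtain k where k: "k \<in> indices" "(s, t) \<in> open_triangle k"
        by blast
      have "((\<lambda>t. a k + b k * s + c k * t) has_real_derivative c k) (at t)"
        by (auto intro!: derivative_eq_intros)
      moreover have "open ((\<lambda>t. (s, t)) -` open_triangle k)"
        using open_open_triangle by (intro open_vimage) (auto intro!: continuous_intros)
      ultimately have "((\<lambda>t. u (s, t)) has_real_derivative c k) (at t)"
      proof (rule has_field_derivative_transform_within_open)
        show "t \<in> (\<lambda>t. (s, t)) -` open_triangle k" using k(2) by simp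
        show "a k + b k * s + c k * r = u (s, r)" if "r \<in> (\<lambda>t. (s, t)) -` open_triangle k" for r
          using aff[OF k(1), of s r] that by simp
      qed
      with k show ?thesis by (simp add: piecewise_eq)
    qed
    show ?thesis
      unfolding ind
    proof (rule integral_product_derivative_zero[OF L_pos finite_skeleton_column[OF s] _ der
          test_function_derivative_snd[OF \<zeta>]])
      show "continuous_on {0..L} (\<lambda>t. u (s, t))"
        using True by (intro continuous_on_compose2[OF u]) (auto intro!: continuous_intros simp: closed_square_def)
      show "\<zeta> (s, 0) = 0" "\<zeta> (s, L) = 0"
        using test_functionsD(4)[OF \<zeta>] by (auto simp: square_def)
    qed (use int in \<open>simp_all only: ind\<close>)
  qed (auto simp: square_def)
  have "AE s in lborel. s \<notin> x ` {..<n}"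
    by (intro AE_not_in countable_imp_null_set_lborel countable_finite) auto
  with lborel_pair.AE_integrable_fst[OF int] have "AE s in lborel. (LINT t|lborel. ?h s t) = 0"
    by eventually_elim (rule column)
  then have "(LINT s|lborel. LINT t|lborel. ?h s t) = 0"
    by (rule integral_eq_zero_AE)
  then show "(LINT z|lborel. indicator (square L) z *
      (?g z * \<zeta> z + u z * frechet_derivative \<zeta> (at z) (0, 1))) = 0"
    unfolding lborel_pair.integral_fst[OF int] by (simp add: lborel_prod case_prod_unfold)
qed (auto simp: piecewise_const_continuous piecewise_const_borel)

end

section \<open>Skew-symmetry of the convection term and stability\<close>

text \<open>The left side is six times the integral of (V(u) . grad v) v over the counterclockwise
  triangle PQR: the Jacobian of (u, v), times twice the area, times three times the mean of the
  affine v.\<close>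

lemma triangle_edge_identity:
  fixes a b c A B C p1 p2 q1 q2 r1 r2 :: real
  assumes "Up = a + b * p1 + c * p2" "Uq = a + b * q1 + c * q2" "Ur = a + b * r1 + c * r2"
    and "Vp = A + B * p1 + C * p2" "Vq = A + B * q1 + C * q2" "Vr = A + B * r1 + C * r2"
  shows "(b * C - c * B) * ((q1 - p1) * (r2 - p2) - (r1 - p1) * (q2 - p2)) * (Vp + Vq + Vr) =
    - ((Uq - Up) * (Vp\<^sup>2 + Vp * Vq + Vq\<^sup>2) + (Ur - Uq) * (Vq\<^sup>2 + Vq * Vr + Vr\<^sup>2) +
       (Up - Ur) * (Vr\<^sup>2 + Vr * Vp + Vp\<^sup>2))"
proof -
  \<comment> \<open>By multiplicativity of determinants the Jacobian times twice the area is
    \<open>U1 * V2 - U2 * V1\<close>. The coordinates disappear, leaving a polynomial identity in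
    vertex values.\<close>
  define U1 U2 V1 V2 where "U1 = Uq - Up" and "U2 = Ur - Up" and "V1 = Vq - Vp" and "V2 = Vr - Vp"
  have J: "(b * C - c * B) * ((q1 - p1) * (r2 - p2) - (r1 - p1) * (q2 - p2)) = U1 * V2 - U2 * V1"
    unfolding U1_def U2_def V1_def V2_def assms by (simp add: algebra_simps)
  have *: "Uq = Up + U1" "Ur = Up + U2" "Vq = Vp + V1" "Vr = Vp + V2"
    by (simp_all add: U1_def U2_def V1_def V2_def)
  show ?thesis
    unfolding J * by algebra
qed

text \<open>Makes the \<open>SOME\<close> choice harmless: one explicit weak derivative guarantees
  that the chosen function is a weak derivative too, and uniqueness identifies the two.\<close>

lemma weak_partial_AE:
  assumes "open \<Omega>" "has_weak_partial \<Omega> u e g"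
  shows "AE z in lebesgue_on \<Omega>. weak_partial \<Omega> e u z = g z"
  unfolding weak_partial_def
  by (rule weak_partial_unique_AE[OF assms(1) someI[of "has_weak_partial \<Omega> u e", OF assms(2)] assms(2)])

lemma integral_AE_eq:
  fixes f g :: "'a::euclidean_space \<Rightarrow> real"
  assumes "S \<in> sets lebesgue" "integrable (lebesgue_on S) f" "AE z in lebesgue_on S. f z = g z"
  shows "integrable (lebesgue_on S) g" "(LINT z|lebesgue_on S. g z) = (LINT z|lebesgue_on S. f z)"
proof -
  have g: "g \<in> borel_measurable (lebesgue_on S)"
    using borel_measurable_lebesgue_on_AE[OF assms(1) borel_measurable_integrable[OF assms(2)] assms(3)] .
  show "integrable (lebesgue_on S) g"
    using integrable_cong_AE_imp[OF assms(2) g] assms(3) by blast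
  show "(LINT z|lebesgue_on S. g z) = (LINT z|lebesgue_on S. f z)"
    using assms(2,3) g by (intro integral_cong_AE) (auto simp: eq_commute)
qed

text \<open>Each summand is the counterclockwise circulation around a cell, with \<open>h\<close> on
  horizontal and \<open>w\<close> on vertical sides. Inner sides telescope away and periodicity
  pairs the outer ones.\<close>

lemma sum_grid_boundary_zero:
  fixes h w :: "nat \<Rightarrow> nat \<Rightarrow> real"
  assumes "\<And>i. i < m \<Longrightarrow> h i 0 = h i m" "\<And>j. j < m \<Longrightarrow> w 0 j = w m j"
  shows "(\<Sum>i<m. \<Sum>j<m. h i j + w (Suc i) j - h i (Suc j) - w i j) = 0"
proof -
  have "(\<Sum>i<m. \<Sum>j<m. h i j + w (Suc i) j - h i (Suc j) - w i j) =
      (\<Sum>i<m. \<Sum>j<m. w (Suc i) j - w i j) - (\<Sum>i<m. \<Sum>j<m. h i (Suc j) - h i j)"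
    by (simp add: algebra_simps flip: sum_subtractf sum.distrib)
  also have "(\<Sum>i<m. \<Sum>j<m. h i (Suc j) - h i j) = (\<Sum>i<m. h i m - h i 0)"
    by (simp only: sum_lessThan_telescope)
  also have "(\<Sum>i<m. \<Sum>j<m. w (Suc i) j - w i j) = (\<Sum>j<m. \<Sum>i<m. w (Suc i) j - w i j)"
    by (rule sum.swap)
  also have "\<dots> = (\<Sum>j<m. w m j - w 0 j)"
    by (rule sum.cong[OF refl], rule sum_lessThan_telescope[of "\<lambda>i. w i j" for j])
  finally show ?thesis using assms by simp
qed

lemma sum_UNIV_bool: "(\<Sum>r\<in>UNIV. f r) = f True + f False" for f :: "bool \<Rightarrow> real"
  by (simp add: UNIV_bool add.commute)

section \<open>Exact integrals over triangles and cells\<close>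

context square_triangulation
begin

lemma diagonal_slope_eq:
  assumes "j < n - 1"
  shows "diagonal_slope i j * (y (Suc j) - y j) = diagonal_top i j - diagonal_bot i j"
  using y_step[OF assms] by (simp add: diagonal_slope_def)

lemma diagonal_ends:
  assumes "j < n - 1"
  shows "diagonal i j (y j) = diagonal_bot i j" "diagonal i j (y (Suc j)) = diagonal_top i j"
  using diagonal_slope_eq[OF assms, of i] by (simp_all add: diagonal_def mult.commute)

lemma diagonal_bounds:
  assumes "i < n - 1" "j < n - 1" "y j \<le> t" "t \<le> y (Suc j)"
  shows "x i \<le> diagonal i j t" "diagonal i j t \<le> x (Suc i)"
proof -
  define \<theta> where "\<theta> = (t - y j) / (y (Suc j) - y j)"
  have \<theta>: "0 \<le> \<theta>" "\<theta> \<le> 1" using assms y_step[OF assms(2)] by (auto simp: \<theta>_def)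
  have "diagonal i j t = diagonal_bot i j + \<theta> * (diagonal_top i j - diagonal_bot i j)"
    by (simp add: diagonal_def diagonal_slope_def \<theta>_def)
  moreover have "0 \<le> \<theta> * (x (Suc i) - x i)" "\<theta> * (x (Suc i) - x i) \<le> 1 * (x (Suc i) - x i)"
    using \<theta> x_step[OF assms(1)] by (auto intro!: mult_nonneg_nonneg mult_right_mono)
  ultimately show "x i \<le> diagonal i j t" "diagonal i j t \<le> x (Suc i)"
    by (auto simp: diagonal_bot_def diagonal_top_def right_diff_distrib)
qed

text \<open>Area times the mean of the three vertex values: the two ends of the diagonal and the
  corner selected by \<open>r\<close>.\<close>

lemma affine_integral_triangle:
  fixes A B C :: real
  assumes ij: "i < n - 1" "j < n - 1"
  defines "f \<equiv> \<lambda>s t. A + B * s + C * t"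
  shows "(LINT z|lborel. indicator (open_triangle (i, j, r)) z * (A + B * fst z + C * snd z)) =
    (x (Suc i) - x i) * (y (Suc j) - y j) / 6 *
      (if d i j then f (x i) (y j) + f (x (Suc i)) (y (Suc j)) +
          (if r then f (x (Suc i)) (y j) else f (x i) (y (Suc j)))
       else f (x (Suc i)) (y j) + f (x i) (y (Suc j)) +
          (if r then f (x (Suc i)) (y (Suc j)) else f (x i) (y j)))"
proof -
  have int: "integrable lborel (\<lambda>z. indicator (open_triangle (i, j, r)) z * (A + B * fst z + C * snd z))" for r
    using ij by (intro integrable_on_triangle) (auto simp: indices_def intro!: continuous_intros)
  define m E where "m = diagonal_slope i j" and "E = y (Suc j) - y j"
  have E: "E > 0" using y_step[OF ij(2)] by (simp add: E_def)
  have mE: "m * E = diagonal_top i j - diagonal_bot i j"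
    using diagonal_slope_eq[OF ij(2)] by (simp add: m_def E_def)
  \<comment> \<open>\<open>m * E\<close> is the signed width of the cell, with a sign that depends
    on the diagonal. Eliminating the far nodes turns both orientations into polynomial
    identities.\<close>
  have x1: "x (Suc i) = (if d i j then x i + m * E else x i - m * E)"
    using mE by (simp add: diagonal_bot_def diagonal_top_def)
  have y1: "y (Suc j) = y j + E" by (simp add: E_def)
  show ?thesis
  proof (cases r)
    case True
    \<comment> \<open>The diagonal stays within the cell, so the other vertical bound is redundant;
      the triangle is a trapezoid with one vertical side, written with slope 0.\<close>
    have T: "open_triangle (i, j, True) = {z. y j < snd z \<and> snd z < y (Suc j) \<and>
        diagonal_bot i j + (snd z - y j) * m < fst z \<and> fst z < x (Suc i) + (snd z - y j) * 0}"
    proof (rule set_eqI)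
      fix z
      show "z \<in> open_triangle (i, j, True) \<longleftrightarrow> z \<in> {z. y j < snd z \<and> snd z < y (Suc j) \<and>
        diagonal_bot i j + (snd z - y j) * m < fst z \<and> fst z < x (Suc i) + (snd z - y j) * 0}"
        using diagonal_bounds(1)[OF ij, of "snd z"]
        by (cases z) (auto simp: open_triangle_def diagonal_def m_def)
    qed
    have "(LINT z|lborel. indicator (open_triangle (i, j, True)) z * (A + B * fst z + C * snd z)) =
      (y (Suc j) - y j) * ((x (Suc i) - diagonal_bot i j) * (A + C * y j + B * ((diagonal_bot i j + x (Suc i)) / 2)) +
      ((x (Suc i) - diagonal_bot i j) * (C + B * ((m + 0) / 2)) + (0 - m) * (A + C * y j + B * ((diagonal_bot i j + x (Suc i)) / 2))) * (y (Suc j) - y j) / 2 +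
      (0 - m) * (C + B * ((m + 0) / 2)) * (y (Suc j) - y j)\<^sup>2 / 3)"
      unfolding T
    proof (rule trapezoid_integral)
      show "diagonal_bot i j + (t - y j) * m \<le> x (Suc i) + (t - y j) * 0" if "y j < t" "t < y (Suc j)" for t
        using diagonal_bounds(2)[OF ij, of t] that by (simp add: diagonal_def m_def)
    qed (use int[of True] y_step[OF ij(2)] in \<open>simp_all only: T\<close>)
    then show ?thesis
      using True unfolding f_def diagonal_bot_def x1 y1
      by (cases "d i j") (simp_all add: algebra_simps power2_eq_square add_divide_distrib diff_divide_distrib)
  next
    case False
    have T: "open_triangle (i, j, False) = {z. y j < snd z \<and> snd z < y (Suc j) \<and>
        x i + (snd z - y j) * 0 < fst z \<and> fst z < diagonal_bot i j + (snd z - y j) * m}"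
    proof (rule set_eqI)
      fix z
      show "z \<in> open_triangle (i, j, False) \<longleftrightarrow> z \<in> {z. y j < snd z \<and> snd z < y (Suc j) \<and>
        x i + (snd z - y j) * 0 < fst z \<and> fst z < diagonal_bot i j + (snd z - y j) * m}"
        using diagonal_bounds(2)[OF ij, of "snd z"]
        by (cases z) (auto simp: open_triangle_def diagonal_def m_def)
    qed
    have "(LINT z|lborel. indicator (open_triangle (i, j, False)) z * (A + B * fst z + C * snd z)) =
      (y (Suc j) - y j) * ((diagonal_bot i j - x i) * (A + C * y j + B * ((x i + diagonal_bot i j) / 2)) +
      ((diagonal_bot i j - x i) * (C + B * ((0 + m) / 2)) + (m - 0) * (A + C * y j + B * ((x i + diagonal_bot i j) / 2))) * (y (Suc j) - y j) / 2 +
      (m - 0) * (C + B * ((0 + m) / 2)) * (y (Suc j) - y j)\<^sup>2 / 3)"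
      unfolding T
    proof (rule trapezoid_integral)
      show "x i + (t - y j) * 0 \<le> diagonal_bot i j + (t - y j) * m" if "y j < t" "t < y (Suc j)" for t
        using diagonal_bounds(1)[OF ij, of t] that by (simp add: diagonal_def m_def)
    qed (use int[of False] y_step[OF ij(2)] in \<open>simp_all only: T\<close>)
    then show ?thesis
      using False unfolding f_def diagonal_bot_def x1 y1
      by (cases "d i j") (simp_all add: algebra_simps power2_eq_square add_divide_distrib diff_divide_distrib)
  qed
qed

lemma X_N_coefficients:
  assumes "v \<in> X_N L triangles"
  obtains a b c where
    "\<And>k s t. k \<in> indices \<Longrightarrow> (s, t) \<in> closed_triangle k \<Longrightarrow> v (s, t) = a k + b k * s + c k * t"
proof -
  have "\<exists>q. \<forall>s t. (s, t) \<in> closed_triangle k \<longrightarrow>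
      v (s, t) = fst q + fst (snd q) * s + snd (snd q) * t" if k: "k \<in> indices" for k
  proof -
    obtain a b c where "\<And>s t. (s, t) \<in> closed_triangle k \<Longrightarrow> v (s, t) = a + b * s + c * t"
      by (rule X_N_affine[OF assms k]) (rule that)
    then show ?thesis by (intro exI[of _ "(a, b, c)"]) simp
  qed
  then have "\<forall>k\<in>indices. \<exists>q. \<forall>s t. (s, t) \<in> closed_triangle k \<longrightarrow>
      v (s, t) = fst q + fst (snd q) * s + snd (snd q) * t" by (rule ballI)
  from bchoice[OF this] obtain q where "\<forall>k\<in>indices. \<forall>s t. (s, t) \<in> closed_triangle k \<longrightarrow>
      v (s, t) = fst (q k) + fst (snd (q k)) * s + snd (snd (q k)) * t" ..
  then show ?thesis
    by (intro that[of "\<lambda>k. fst (q k)" "\<lambda>k. fst (snd (q k))" "\<lambda>k. snd (snd (q k))"]) simp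
qed

text \<open>The two triangles traverse the diagonal in opposite directions, so its terms cancel and
  the result no longer depends on \<open>d i j\<close>.\<close>

lemma cell_integral_eq_boundary:
  assumes ij: "i < n - 1" "j < n - 1"
    and u: "\<And>r s t. (s, t) \<in> closed_triangle (i, j, r) \<Longrightarrow> u (s, t) = a r + b r * s + c r * t"
    and v: "\<And>r s t. (s, t) \<in> closed_triangle (i, j, r) \<Longrightarrow> v (s, t) = A r + B r * s + C r * t"
  defines "edge \<equiv> \<lambda>p q. (u q - u p) * ((v p)\<^sup>2 + v p * v q + (v q)\<^sup>2)"
  shows "(\<Sum>r\<in>UNIV. (b r * C r - c r * B r) *
      (LINT z|lborel. indicator (open_triangle (i, j, r)) z * (A r + B r * fst z + C r * snd z))) =
    - (edge (x i, y j) (x (Suc i), y j) + edge (x (Suc i), y j) (x (Suc i), y (Suc j))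
       - edge (x i, y (Suc j)) (x (Suc i), y (Suc j)) - edge (x i, y j) (x i, y (Suc j))) / 6"
proof -
  note xy = x_step[OF ij(1)] y_step[OF ij(2)]
  \<comment> \<open>Corners lie in the closed triangles, so both affine formulas can be traded for
    the values of \<open>u\<close> and \<open>v\<close> themselves. Only after that do the terms of
    the shared edge match.\<close>
  have mem: "(x i, y j) \<in> closed_triangle (i, j, r) \<longleftrightarrow> d i j \<or> \<not> r"
    "(x (Suc i), y j) \<in> closed_triangle (i, j, r) \<longleftrightarrow> \<not> d i j \<or> r"
    "(x i, y (Suc j)) \<in> closed_triangle (i, j, r) \<longleftrightarrow> \<not> d i j \<or> \<not> r"
    "(x (Suc i), y (Suc j)) \<in> closed_triangle (i, j, r) \<longleftrightarrow> d i j \<or> r" for r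
    using xy by (auto simp: closed_triangle_def diagonal_ends[OF ij(2)] diagonal_bot_def diagonal_top_def)
  define D E where "D = x (Suc i) - x i" and "E = y (Suc j) - y j"
  show ?thesis
  proof (cases "d i j")
    case True
    \<comment> \<open>In all four uses the vertices are listed counterclockwise, which fixes the
      signs of the edge terms.\<close>
    have right: "(b True * C True - c True * B True) * ((x (Suc i) - x i) * (y (Suc j) - y j) - (x (Suc i) - x i) * (y j - y j)) *
        (v (x i, y j) + v (x (Suc i), y j) + v (x (Suc i), y (Suc j))) =
      - ((u (x (Suc i), y j) - u (x i, y j)) * ((v (x i, y j))\<^sup>2 + v (x i, y j) * v (x (Suc i), y j) + (v (x (Suc i), y j))\<^sup>2) +
         (u (x (Suc i), y (Suc j)) - u (x (Suc i), y j)) * ((v (x (Suc i), y j))\<^sup>2 + v (x (Suc i), y j) * v (x (Suc i), y (Suc j)) + (v (x (Suc i), y (Suc j)))\<^sup>2) +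
         (u (x i, y j) - u (x (Suc i), y (Suc j))) * ((v (x (Suc i), y (Suc j)))\<^sup>2 + v (x (Suc i), y (Suc j)) * v (x i, y j) + (v (x i, y j))\<^sup>2))"
      by (rule triangle_edge_identity[OF u[of _ _ True] u[of _ _ True] u[of _ _ True]
          v[of _ _ True] v[of _ _ True] v[of _ _ True]]) (simp_all add: mem True)
    have left: "(b False * C False - c False * B False) * ((x (Suc i) - x i) * (y (Suc j) - y j) - (x i - x i) * (y (Suc j) - y j)) *
        (v (x i, y j) + v (x (Suc i), y (Suc j)) + v (x i, y (Suc j))) =
      - ((u (x (Suc i), y (Suc j)) - u (x i, y j)) * ((v (x i, y j))\<^sup>2 + v (x i, y j) * v (x (Suc i), y (Suc j)) + (v (x (Suc i), y (Suc j)))\<^sup>2) +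
         (u (x i, y (Suc j)) - u (x (Suc i), y (Suc j))) * ((v (x (Suc i), y (Suc j)))\<^sup>2 + v (x (Suc i), y (Suc j)) * v (x i, y (Suc j)) + (v (x i, y (Suc j)))\<^sup>2) +
         (u (x i, y j) - u (x i, y (Suc j))) * ((v (x i, y (Suc j)))\<^sup>2 + v (x i, y (Suc j)) * v (x i, y j) + (v (x i, y j))\<^sup>2))"
      by (rule triangle_edge_identity[OF u[of _ _ False] u[of _ _ False] u[of _ _ False]
          v[of _ _ False] v[of _ _ False] v[of _ _ False]]) (simp_all add: mem True)
    have intR: "(LINT z|lborel. indicator (open_triangle (i, j, True)) z * (A True + B True * fst z + C True * snd z)) =
        D * E / 6 * (v (x i, y j) + v (x (Suc i), y j) + v (x (Suc i), y (Suc j)))"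
      using True by (simp add: affine_integral_triangle[OF ij] D_def E_def v[of _ _ True] mem)
    have intL: "(LINT z|lborel. indicator (open_triangle (i, j, False)) z * (A False + B False * fst z + C False * snd z)) =
        D * E / 6 * (v (x i, y j) + v (x (Suc i), y (Suc j)) + v (x i, y (Suc j)))"
      using True by (simp add: affine_integral_triangle[OF ij] D_def E_def v[of _ _ False] mem)
    \<comment> \<open>Twice the area of a triangle, spelled out in the exact shapes that occur on
      the left of \<open>right\<close> and \<open>left\<close>.\<close>
    have det: "D * E = ((x (Suc i) - x i) * (y (Suc j) - y j) - (x (Suc i) - x i) * (y j - y j))"
      "D * E = ((x (Suc i) - x i) * (y (Suc j) - y j) - (x i - x i) * (y (Suc j) - y j))"
      by (simp_all add: D_def E_def left_diff_distrib)
    have regroup: "J * (K / 6 * S) = J * K * S / 6" for J K S :: real by simp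
    show ?thesis
      unfolding sum_UNIV_bool intR intL regroup
      by (subst det(1), subst right, subst det(2), subst left)
        (simp add: edge_def field_simps power2_eq_square)
  next
    case False
    have right: "(b True * C True - c True * B True) * ((x (Suc i) - x (Suc i)) * (y (Suc j) - y j) - (x i - x (Suc i)) * (y (Suc j) - y j)) *
        (v (x (Suc i), y j) + v (x (Suc i), y (Suc j)) + v (x i, y (Suc j))) =
      - ((u (x (Suc i), y (Suc j)) - u (x (Suc i), y j)) * ((v (x (Suc i), y j))\<^sup>2 + v (x (Suc i), y j) * v (x (Suc i), y (Suc j)) + (v (x (Suc i), y (Suc j)))\<^sup>2) +
         (u (x i, y (Suc j)) - u (x (Suc i), y (Suc j))) * ((v (x (Suc i), y (Suc j)))\<^sup>2 + v (x (Suc i), y (Suc j)) * v (x i, y (Suc j)) + (v (x i, y (Suc j)))\<^sup>2) +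
         (u (x (Suc i), y j) - u (x i, y (Suc j))) * ((v (x i, y (Suc j)))\<^sup>2 + v (x i, y (Suc j)) * v (x (Suc i), y j) + (v (x (Suc i), y j))\<^sup>2))"
      by (rule triangle_edge_identity[OF u[of _ _ True] u[of _ _ True] u[of _ _ True]
          v[of _ _ True] v[of _ _ True] v[of _ _ True]]) (simp_all add: mem False)
    have left: "(b False * C False - c False * B False) * ((x (Suc i) - x i) * (y (Suc j) - y j) - (x i - x i) * (y j - y j)) *
        (v (x i, y j) + v (x (Suc i), y j) + v (x i, y (Suc j))) =
      - ((u (x (Suc i), y j) - u (x i, y j)) * ((v (x i, y j))\<^sup>2 + v (x i, y j) * v (x (Suc i), y j) + (v (x (Suc i), y j))\<^sup>2) +
         (u (x i, y (Suc j)) - u (x (Suc i), y j)) * ((v (x (Suc i), y j))\<^sup>2 + v (x (Suc i), y j) * v (x i, y (Suc j)) + (v (x i, y (Suc j)))\<^sup>2) +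
         (u (x i, y j) - u (x i, y (Suc j))) * ((v (x i, y (Suc j)))\<^sup>2 + v (x i, y (Suc j)) * v (x i, y j) + (v (x i, y j))\<^sup>2))"
      by (rule triangle_edge_identity[OF u[of _ _ False] u[of _ _ False] u[of _ _ False]
          v[of _ _ False] v[of _ _ False] v[of _ _ False]]) (simp_all add: mem False)
    have intR: "(LINT z|lborel. indicator (open_triangle (i, j, True)) z * (A True + B True * fst z + C True * snd z)) =
        D * E / 6 * (v (x (Suc i), y j) + v (x (Suc i), y (Suc j)) + v (x i, y (Suc j)))"
      using False by (simp add: affine_integral_triangle[OF ij] D_def E_def v[of _ _ True] mem)
    have intL: "(LINT z|lborel. indicator (open_triangle (i, j, False)) z * (A False + B False * fst z + C False * snd z)) =
        D * E / 6 * (v (x i, y j) + v (x (Suc i), y j) + v (x i, y (Suc j)))"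
      using False by (simp add: affine_integral_triangle[OF ij] D_def E_def v[of _ _ False] mem)
    have det: "D * E = ((x (Suc i) - x (Suc i)) * (y (Suc j) - y j) - (x i - x (Suc i)) * (y (Suc j) - y j))"
      "D * E = ((x (Suc i) - x i) * (y (Suc j) - y j) - (x i - x i) * (y j - y j))"
      by (simp_all add: D_def E_def left_diff_distrib)
    have regroup: "J * (K / 6 * S) = J * K * S / 6" for J K S :: real by simp
    show ?thesis
      unfolding sum_UNIV_bool intR intL regroup
      by (subst det(1), subst right, subst det(2), subst left)
        (simp add: edge_def field_simps power2_eq_square)
  qed
qed

end

text \<open>Measurability of the chosen derivative is inherited from the representative in
  \<open>L_inf\<close>; the pointwise bound comes from the essential supremum of the chosen
  derivative itself.\<close>

lemma W1_inf_weak_partial: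
  assumes \<Omega>: "open \<Omega>" and p: "p \<in> W1_inf \<Omega>" and e: "e \<in> Basis"
    and P: "linf_norm \<Omega> (weak_partial \<Omega> e p) \<le> ereal P"
  shows "weak_partial \<Omega> e p \<in> borel_measurable (lebesgue_on \<Omega>)"
    "AE z in lebesgue_on \<Omega>. \<bar>weak_partial \<Omega> e p z\<bar> \<le> P"
proof -
  obtain g where g: "g \<in> L_inf \<Omega>" "has_weak_partial \<Omega> p e g"
    using p e by (auto simp: W1_inf_def)
  have "AE z in lebesgue_on \<Omega>. g z = weak_partial \<Omega> e p z"
    using weak_partial_AE[OF \<Omega> g(2)] by eventually_elim simp
  then show "weak_partial \<Omega> e p \<in> borel_measurable (lebesgue_on \<Omega>)"
    by (rule borel_measurable_lebesgue_on_AE[rotated -1]) (use g(1) \<Omega> in \<open>simp_all add: L_inf_def\<close>)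
  have "AE z in lebesgue_on \<Omega>. ereal \<bar>weak_partial \<Omega> e p z\<bar> \<le> linf_norm \<Omega> (weak_partial \<Omega> e p)"
    unfolding linf_norm_def by (rule esssup_AE)
  then show "AE z in lebesgue_on \<Omega>. \<bar>weak_partial \<Omega> e p z\<bar> \<le> P"
  proof eventually_elim
    case (elim z)
    then have "ereal \<bar>weak_partial \<Omega> e p z\<bar> \<le> ereal P" using P by (rule order_trans)
    then show ?case by simp
  qed
qed

text \<open>Translates the extended-real restriction into real numbers. Positivity of \<tau>
  excludes a negative norm, and also an infinite one, for which the quotient would be 0.\<close>

lemma step_size_bound:
  assumes "0 < \<tau>" "ereal \<tau> \<le> 1 / (4 * w)"
  obtains P where "w = ereal P" "0 \<le> P" "\<tau> * P \<le> 1 / 4"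
proof (cases w)
  case (real P)
  show thesis
  \<comment> \<open>Here the bound on \<tau> is \<open>1 / 0\<close>, which is infinite, and \<tau>
    * P = 0 anyway.\<close>
  proof (cases "P = 0")
    case True
    with real that[of P] show thesis by simp
  next
    case False
    then have "1 / (4 * w) = ereal (1 / (4 * P))"
      using real by (simp add: one_ereal_def numeral_eq_ereal)
    then have le: "\<tau> \<le> 1 / (4 * P)" using assms by simp
    then have "0 < 1 / (4 * P)" using assms by linarith
    then have "0 < P" by (simp add: zero_less_divide_iff)
    with le real that[of P] show thesis by (simp add: field_simps)
  qed
next
  case PInf
  then show thesis using assms by simp
next
  case MInf
  then show thesis using assms by simp
qed

section \<open>Energy estimate for one time step\<close>

context square_triangulation
begin

lemma X_NP_nodes:
  assumes "v \<in> X_NP L triangles" "i < n" "j < n"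
  shows "v (x i, y 0) = v (x i, y (n - 1))" "v (x 0, y j) = v (x (n - 1), y j)"
proof -
  have "0 \<le> x i" "x i \<le> L" "0 \<le> y j" "y j \<le> L"
    using grid_1d_le[OF grid_x, of 0 i] grid_1d_le[OF grid_x, of i "n - 1"]
      grid_1d_le[OF grid_y, of 0 j] grid_1d_le[OF grid_y, of j "n - 1"] grid_x grid_y assms(2,3)
    by (auto simp: grid_1d_def)
  then show "v (x i, y 0) = v (x i, y (n - 1))" "v (x 0, y j) = v (x (n - 1), y j)"
    using assms(1) grid_x grid_y by (auto simp: X_NP_def grid_1d_def)
qed

lemma X_N_gradient:
  assumes v: "v \<in> X_N L triangles"
    and aff: "\<And>k s t. k \<in> indices \<Longrightarrow> (s, t) \<in> closed_triangle k \<Longrightarrow> v (s, t) = a k + b k * s + c k * t"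
  shows "piecewise_continuous v"
    "AE z in lebesgue_on (square L). weak_dx (square L) v z = piecewise (\<lambda>k _. b k) z"
    "AE z in lebesgue_on (square L). weak_dy (square L) v z = piecewise (\<lambda>k _. c k) z"
proof -
  have aff': "v (s, t) = a k + b k * s + c k * t" if "k \<in> indices" "(s, t) \<in> open_triangle k" for k s t
    using aff[OF that(1)] that(2) open_triangle_subset_closed by blast
  have cont: "continuous_on (closed_square L) v" using v by (simp add: X_N_def)
  show "piecewise_continuous v" using aff' by (rule piecewise_affine_continuous)
  show "AE z in lebesgue_on (square L). weak_dx (square L) v z = piecewise (\<lambda>k _. b k) z"
    by (rule weak_partial_AE[OF open_square piecewise_affine_has_weak_dx[OF cont aff']])
  show "AE z in lebesgue_on (square L). weak_dy (square L) v z = piecewise (\<lambda>k _. c k) z"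
    by (rule weak_partial_AE[OF open_square piecewise_affine_has_weak_dy[OF cont aff']])
qed

text \<open>On a triangle V(u) . grad v is the constant \<open>b k * C k - c k * B k\<close>, so the
  integrand is affine there and its integral is known exactly.\<close>

lemma convection_skew:
  assumes u: "u \<in> X_NP L triangles" and v: "v \<in> X_NP L triangles"
  shows "integrable (lebesgue_on (square L)) (\<lambda>z. (Vvec (square L) u z \<bullet> grad (square L) v z) * v z)"
    "(LINT z|lebesgue_on (square L). (Vvec (square L) u z \<bullet> grad (square L) v z) * v z) = 0"
proof -
  have uN: "u \<in> X_N L triangles" and vN: "v \<in> X_N L triangles"
    using u v by (auto simp: X_NP_def)
  obtain a b c where u_aff:
    "\<And>k s t. k \<in> indices \<Longrightarrow> (s, t) \<in> closed_triangle k \<Longrightarrow> u (s, t) = a k + b k * s + c k * t"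
    by (rule X_N_coefficients[OF uN]) (rule that)
  obtain A B C where v_aff:
    "\<And>k s t. k \<in> indices \<Longrightarrow> (s, t) \<in> closed_triangle k \<Longrightarrow> v (s, t) = A k + B k * s + C k * t"
    by (rule X_N_coefficients[OF vN]) (rule that)
  let ?J = "\<lambda>k. b k * C k - c k * B k"
  let ?f = "\<lambda>z. (piecewise (\<lambda>k _. b k) z * piecewise (\<lambda>k _. C k) z -
      piecewise (\<lambda>k _. c k) z * piecewise (\<lambda>k _. B k) z) * v z"
  let ?c = "\<lambda>k z. ?J k * (A k + B k * fst z + C k * snd z)"
  have f: "?f z = ?c k z" if "k \<in> indices" "z \<in> open_triangle k" for k z
  proof -
    have "v z = A k + B k * fst z + C k * snd z"
      using v_aff[OF that(1), of "fst z" "snd z"] subsetD[OF open_triangle_subset_closed that(2)] by simp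
    then show ?thesis using that by (simp add: piecewise_eq)
  qed
  have cont: "continuous_on UNIV (?c k)" for k
    by (intro continuous_intros)
  have int: "integrable (lebesgue_on (square L)) ?f"
    "(LINT z|lebesgue_on (square L). ?f z) = (\<Sum>k\<in>indices. LINT z|lborel. indicator (open_triangle k) z * ?c k z)"
    by (rule integral_piecewise(1)[of ?c], rule cont, rule f, assumption+)
      (rule integral_piecewise(2), rule cont, rule f, assumption+)
  have "AE z in lebesgue_on (square L). weak_dx (square L) u z = piecewise (\<lambda>k _. b k) z"
    "AE z in lebesgue_on (square L). weak_dy (square L) u z = piecewise (\<lambda>k _. c k) z"
    by (rule X_N_gradient(2)[OF uN], rule u_aff, assumption+)
      (rule X_N_gradient(3)[OF uN], rule u_aff, assumption+)
  moreover have "AE z in lebesgue_on (square L). weak_dx (square L) v z = piecewise (\<lambda>k _. B k) z"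
    "AE z in lebesgue_on (square L). weak_dy (square L) v z = piecewise (\<lambda>k _. C k) z"
    by (rule X_N_gradient(2)[OF vN], rule v_aff, assumption+)
      (rule X_N_gradient(3)[OF vN], rule v_aff, assumption+)
  ultimately have "AE z in lebesgue_on (square L). ?f z = (Vvec (square L) u z \<bullet> grad (square L) v z) * v z"
    by eventually_elim (simp add: Vvec_def grad_def inner_prod_def)
  note eq = integral_AE_eq[OF _ int(1) this]
  show "integrable (lebesgue_on (square L)) (\<lambda>z. (Vvec (square L) u z \<bullet> grad (square L) v z) * v z)"
    using eq(1) open_square by simp
  define edge where "edge p q = (u q - u p) * ((v p)\<^sup>2 + v p * v q + (v q)\<^sup>2)" for p q
  define h where "h i j = edge (x i, y j) (x (Suc i), y j)" for i j
  define w where "w i j = edge (x i, y j) (x i, y (Suc j))" for i j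
  let ?I = "\<lambda>k. ?J k * (LINT z|lborel. indicator (open_triangle k) z * (A k + B k * fst z + C k * snd z))"
  have "(LINT z|lebesgue_on (square L). (Vvec (square L) u z \<bullet> grad (square L) v z) * v z) =
      (LINT z|lebesgue_on (square L). ?f z)"
    using eq(2) open_square by simp
  also have "\<dots> = (\<Sum>k\<in>indices. ?I k)"
    unfolding int(2) integral_mult_right_zero[symmetric] by (simp only: mult.left_commute)
  also have "\<dots> = (\<Sum>i<n - 1. \<Sum>j<n - 1. \<Sum>r\<in>UNIV. ?I (i, j, r))"
    by (simp add: indices_def sum.cartesian_product case_prod_unfold)
  also have "\<dots> = (\<Sum>i<n - 1. \<Sum>j<n - 1. - (h i j + w (Suc i) j - h i (Suc j) - w i j) / 6)"
  proof (intro sum.cong refl)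
    fix i j assume "i \<in> {..<n - 1}" "j \<in> {..<n - 1}"
    then have ij: "i < n - 1" "j < n - 1" and k: "(i, j, r) \<in> indices" for r
      by (auto simp: indices_def)
    show "(\<Sum>r\<in>UNIV. ?I (i, j, r)) = - (h i j + w (Suc i) j - h i (Suc j) - w i j) / 6"
      unfolding h_def w_def edge_def
      by (rule cell_integral_eq_boundary[OF ij]) (rule u_aff[OF k] v_aff[OF k]; assumption)+
  qed
  also have "\<dots> = - (\<Sum>i<n - 1. \<Sum>j<n - 1. h i j + w (Suc i) j - h i (Suc j) - w i j) / 6"
    by (simp only: sum_negf sum_divide_distrib flip: minus_divide_left)
  also have "\<dots> = 0"
  proof -
    \<comment> \<open>Both endpoints of a boundary edge have partners on the opposite side, so the
      whole edge term is periodic.\<close>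
    have "h i 0 = h i (n - 1)" if "i < n - 1" for i
      using X_NP_nodes(1)[OF u, of i 0] X_NP_nodes(1)[OF u, of "Suc i" 0]
        X_NP_nodes(1)[OF v, of i 0] X_NP_nodes(1)[OF v, of "Suc i" 0] that
      by (simp add: h_def edge_def)
    moreover have "w 0 j = w (n - 1) j" if "j < n - 1" for j
      using X_NP_nodes(2)[OF u, of 0 j] X_NP_nodes(2)[OF u, of 0 "Suc j"]
        X_NP_nodes(2)[OF v, of 0 j] X_NP_nodes(2)[OF v, of 0 "Suc j"] that
      by (simp add: w_def edge_def)
    ultimately show ?thesis by (simp add: sum_grid_boundary_zero)
  qed
  finally show "(LINT z|lebesgue_on (square L). (Vvec (square L) u z \<bullet> grad (square L) v z) * v z) = 0" .
qed

lemma implicit_step_stability: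
  assumes p: "p \<in> W1_inf (square L)"
    and \<tau>: "0 < \<tau>" "ereal \<tau> \<le> 1 / (4 * w1_inf_norm (square L) p)"
    and u: "u \<in> X_NP L triangles" and \<xi>: "\<xi> \<in> X_NP L triangles"
    and \<phi>: "\<phi> \<in> X_NP L triangles" and \<psi>: "\<psi> \<in> X_NP L triangles"
    and evolution: "l2_inner (square L) (\<lambda>z. \<psi> z - \<tau> * (Vvec (square L) u z \<bullet> grad (square L) \<psi> z)
        + \<tau> * (Vvec (square L) p z \<bullet> grad (square L) \<phi> z)) \<psi> = l2_inner (square L) \<xi> \<psi>"
    and elliptic: "h1_inner (square L) \<phi> \<phi> = l2_inner (square L) \<psi> \<phi>"
  shows "(l2_norm (square L) \<phi>)\<^sup>2 + (l2_norm (square L) \<psi>)\<^sup>2 \<le> 8 * (l2_norm (square L) \<xi>)\<^sup>2"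
proof -
  let ?M = "lebesgue_on (square L)"
  have sq: "square L \<in> sets lebesgue" using open_square by simp
  obtain a b c where \<phi>_aff:
    "\<And>k s t. k \<in> indices \<Longrightarrow> (s, t) \<in> closed_triangle k \<Longrightarrow> \<phi> (s, t) = a k + b k * s + c k * t"
    using \<phi> by (auto simp: X_NP_def elim!: X_N_coefficients)
  define gx gy where "gx = piecewise (\<lambda>k _. b k)" and "gy = piecewise (\<lambda>k _. c k)"
  have \<phi>N: "\<phi> \<in> X_N L triangles" using \<phi> by (simp add: X_NP_def)
  have gx: "AE z in ?M. weak_dx (square L) \<phi> z = gx z" and gy: "AE z in ?M. weak_dy (square L) \<phi> z = gy z"
    unfolding gx_def gy_def
    by (rule X_N_gradient(2)[OF \<phi>N], rule \<phi>_aff, assumption+)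
      (rule X_N_gradient(3)[OF \<phi>N], rule \<phi>_aff, assumption+)
  have X_N_pc: "piecewise_continuous v" if v: "v \<in> X_NP L triangles" for v
  proof -
    have "v \<in> X_N L triangles" using v by (simp add: X_NP_def)
    then show ?thesis using X_N_coefficients X_N_gradient(1) by metis
  qed
  note pc = X_N_pc[OF \<xi>] X_N_pc[OF \<phi>] X_N_pc[OF \<psi>]
    piecewise_const_continuous[of b, folded gx_def] piecewise_const_continuous[of c, folded gy_def]
  have prod: "integrable ?M (\<lambda>z. f z * g z)" if "piecewise_continuous f" "piecewise_continuous g" for f g
    using that by (intro piecewise_continuous_integrable piecewise_continuous_mult)
  define S X F G where "S = (LINT z|?M. \<psi> z * \<psi> z)" and "X = (LINT z|?M. \<xi> z * \<xi> z)"
    and "F = (LINT z|?M. \<phi> z * \<phi> z)" and "G = (LINT z|?M. gx z * gx z + gy z * gy z)"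
  have int: "integrable ?M (\<lambda>z. \<psi> z * \<psi> z)" "integrable ?M (\<lambda>z. \<xi> z * \<xi> z)" "integrable ?M (\<lambda>z. \<phi> z * \<phi> z)"
    "integrable ?M (\<lambda>z. \<xi> z * \<psi> z)" "integrable ?M (\<lambda>z. \<psi> z * \<phi> z)"
    "integrable ?M (\<lambda>z. gx z * gx z + gy z * gy z)"
    using pc by (auto intro!: prod)
  have pos: "0 \<le> S" "0 \<le> X" "0 \<le> F" "0 \<le> G"
    unfolding S_def X_def F_def G_def by (auto intro!: integral_nonneg_AE AE_I2)

  have "AE z in ?M. gx z * gx z + gy z * gy z = grad (square L) \<phi> z \<bullet> grad (square L) \<phi> z"
    using gx gy by eventually_elim (simp add: grad_def inner_prod_def)
  then have "(LINT z|?M. grad (square L) \<phi> z \<bullet> grad (square L) \<phi> z) = G"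
    unfolding G_def by (rule integral_AE_eq(2)[OF sq int(6)])
  then have FG: "F + G = (LINT z|?M. \<psi> z * \<phi> z)"
    using elliptic by (simp add: h1_inner_def l2_inner_def F_def)
  \<comment> \<open>With equal weights, half of \<open>F\<close> is absorbed; discarding
    \<open>G\<close> then bounds \<open>F\<close>.\<close>
  have "(LINT z|?M. \<psi> z * \<phi> z) \<le> (LINT z|?M. \<psi> z * \<psi> z / 2 + \<phi> z * \<phi> z / 2)"
  proof (rule integral_mono)
    show "\<psi> z * \<phi> z \<le> \<psi> z * \<psi> z / 2 + \<phi> z * \<phi> z / 2" for z
      using zero_le_square[of "\<psi> z - \<phi> z"] by (simp add: algebra_simps)
  qed (use int in auto)
  also have "\<dots> = S / 2 + F / 2" using int by (simp add: S_def F_def)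
  finally have F_le: "F \<le> S" using FG pos by linarith
  \<comment> \<open>Now the weights make \<open>F\<close> cancel completely, which leaves the
    sharper bound on \<open>G\<close>.\<close>
  have "(LINT z|?M. \<psi> z * \<phi> z) \<le> (LINT z|?M. \<psi> z * \<psi> z / 4 + \<phi> z * \<phi> z)"
  proof (rule integral_mono)
    show "\<psi> z * \<phi> z \<le> \<psi> z * \<psi> z / 4 + \<phi> z * \<phi> z" for z
      using zero_le_square[of "\<psi> z / 2 - \<phi> z"] by (simp add: algebra_simps)
  qed (use int in auto)
  also have "\<dots> = S / 4 + F" using int by (simp add: S_def F_def)
  finally have G_le: "G \<le> S / 4" using FG by linarith

  obtain P where P: "w1_inf_norm (square L) p = ereal P" "0 \<le> P" "\<tau> * P \<le> 1 / 4"
    using step_size_bound[OF \<tau>] .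
  have "linf_norm (square L) (weak_dx (square L) p) \<le> ereal P"
    "linf_norm (square L) (weak_dy (square L) p) \<le> ereal P"
    unfolding P(1)[symmetric] w1_inf_norm_def by (rule Max_ge; simp)+
  then have px: "weak_dx (square L) p \<in> borel_measurable ?M" "AE z in ?M. \<bar>weak_dx (square L) p z\<bar> \<le> P"
    and py: "weak_dy (square L) p \<in> borel_measurable ?M" "AE z in ?M. \<bar>weak_dy (square L) p z\<bar> \<le> P"
    using W1_inf_weak_partial[OF open_square p] by (auto simp: Basis_prod_def)
  let ?K = "\<lambda>z. (Vvec (square L) p z \<bullet> grad (square L) \<phi> z) * \<psi> z"
  \<comment> \<open>The explicit counterpart of \<open>?K\<close>, with the chosen gradient of
    \<phi> replaced by its piecewise constant representative. Integrability is proved here and then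
    transferred.\<close>
  let ?k = "\<lambda>z. (weak_dx (square L) p z * gy z - weak_dy (square L) p z * gx z) * \<psi> z"
  \<comment> \<open>Young's inequality g q \<le> g^2 + q^2 / 4 for each of the two gradient
    components; the two quarters give the half.\<close>
  let ?B = "\<lambda>z. (gx z * gx z + gy z * gy z) + \<psi> z * \<psi> z / 2"
  have kB: "AE z in ?M. \<bar>?k z\<bar> \<le> P * ?B z"
    using px(2) py(2)
  proof eventually_elim
    case (elim z)
    have young: "\<bar>g\<bar> * \<bar>q\<bar> \<le> g * g + q * q / 4" for g q :: real
      using zero_le_square[of "\<bar>g\<bar> - \<bar>q\<bar> / 2"] by (simp add: algebra_simps)
    have "\<bar>?k z\<bar> \<le> (P * \<bar>gy z\<bar> + P * \<bar>gx z\<bar>) * \<bar>\<psi> z\<bar>"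
      unfolding abs_mult
    proof (rule mult_right_mono)
      have "\<bar>weak_dx (square L) p z * gy z - weak_dy (square L) p z * gx z\<bar> \<le>
          \<bar>weak_dx (square L) p z\<bar> * \<bar>gy z\<bar> + \<bar>weak_dy (square L) p z\<bar> * \<bar>gx z\<bar>"
        unfolding abs_mult[symmetric] by (rule abs_triangle_ineq4)
      also have "\<dots> \<le> P * \<bar>gy z\<bar> + P * \<bar>gx z\<bar>"
        using elim by (intro add_mono mult_right_mono) auto
      finally show "\<bar>weak_dx (square L) p z * gy z - weak_dy (square L) p z * gx z\<bar> \<le>
          P * \<bar>gy z\<bar> + P * \<bar>gx z\<bar>" .
    qed simp
    also have "\<dots> = P * (\<bar>gy z\<bar> * \<bar>\<psi> z\<bar> + \<bar>gx z\<bar> * \<bar>\<psi> z\<bar>)"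
      by (simp add: algebra_simps)
    also have "\<dots> \<le> P * ?B z"
      using young[of "gx z" "\<psi> z"] young[of "gy z" "\<psi> z"] \<open>0 \<le> P\<close> by (intro mult_left_mono) auto
    finally show ?case .
  qed
  have meas: "gx \<in> borel_measurable ?M" "gy \<in> borel_measurable ?M" "\<psi> \<in> borel_measurable ?M"
    using pc piecewise_continuous_integrable borel_measurable_integrable by blast+
  have B_int: "integrable ?M (\<lambda>z. P * ?B z)" using int by auto
  have k_int: "integrable ?M ?k"
  proof (rule Bochner_Integration.integrable_bound[OF B_int])
    show "?k \<in> borel_measurable ?M"
      using px(1) py(1) meas by measurable
    show "AE z in ?M. norm (?k z) \<le> norm (P * ?B z)"
      using kB by eventually_elim auto
  qed
  have "AE z in ?M. ?k z = ?K z"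
    using gx gy by eventually_elim (simp add: Vvec_def grad_def inner_prod_def)
  note K = integral_AE_eq[OF sq k_int this]
  have "- (LINT z|?M. ?k z) \<le> (LINT z|?M. P * ?B z)"
    unfolding integral_minus[symmetric]
    using kB B_int k_int by (intro integral_mono_AE) (auto elim!: AE_mp)
  also have "\<dots> = P * (G + S / 2)" using int by (simp add: G_def S_def)
  finally have "\<tau> * - (LINT z|?M. ?k z) \<le> \<tau> * (P * (G + S / 2))"
    using \<tau>(1) by (intro mult_left_mono) auto
  also have "\<dots> = (\<tau> * P) * (G + S / 2)" by simp
  also have "\<dots> \<le> 1 / 4 * (G + S / 2)"
    using P(3) pos by (intro mult_right_mono) auto
  finally have K_le: "- (\<tau> * (LINT z|?M. ?K z)) \<le> G / 4 + S / 8"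
    using K(2) by simp

  note C = convection_skew[OF u \<psi>]
  have "l2_inner (square L) (\<lambda>z. \<psi> z - \<tau> * (Vvec (square L) u z \<bullet> grad (square L) \<psi> z)
        + \<tau> * (Vvec (square L) p z \<bullet> grad (square L) \<phi> z)) \<psi> =
      (LINT z|?M. \<psi> z * \<psi> z - \<tau> * ((Vvec (square L) u z \<bullet> grad (square L) \<psi> z) * \<psi> z) + \<tau> * ?K z)"
    unfolding l2_inner_def by (simp add: algebra_simps)
  also have "\<dots> = S + \<tau> * (LINT z|?M. ?K z)"
    using int C K(1) by (simp add: S_def)
  finally have S_eq: "S + \<tau> * (LINT z|?M. ?K z) = (LINT z|?M. \<xi> z * \<psi> z)"
    using evolution by (simp add: l2_inner_def)
  have "(LINT z|?M. \<xi> z * \<psi> z) \<le> (LINT z|?M. \<xi> z * \<xi> z + \<psi> z * \<psi> z / 4)"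
  proof (rule integral_mono)
    show "\<xi> z * \<psi> z \<le> \<xi> z * \<xi> z + \<psi> z * \<psi> z / 4" for z
      using zero_le_square[of "\<xi> z - \<psi> z / 2"] by (simp add: algebra_simps)
  qed (use int in auto)
  also have "\<dots> = X + S / 4" using int by (simp add: S_def X_def)
  \<comment> \<open>With \<open>G \<le> S / 4\<close> the term in p costs at most (1/16 + 1/8) S =
    3/16 S, and the source term costs S / 4. Thus 9/16 S \<le> X, and \<open>F \<le> S\<close> gives
    F + S \<le> 32/9 X.\<close>
  finally have "F + S \<le> 8 * X" using S_eq K_le F_le G_le pos by linarith
  then show ?thesis
    using pos by (simp add: l2_norm_def l2_inner_def S_def X_def F_def)
qed

end

theorem theorem4p3:
  fixes L h c0inv \<tau> t :: real
    and n N :: nat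
    and x y :: "nat \<Rightarrow> real"
    and \<Omega> :: "(real \<times> real) set"
    and T :: "(real \<times> real) set set"
    and p u\<^sub>N \<xi>\<^sub>N \<phi>\<^sub>N \<psi>\<^sub>N :: "real \<times> real \<Rightarrow> real"
    and \<phi> :: "nat \<Rightarrow> real \<times> real \<Rightarrow> real"
    and W :: "real \<Rightarrow> nat \<Rightarrow> real"
    and w\<^sub>N :: "real \<Rightarrow> real \<times> real \<Rightarrow> real"
  assumes "L > 0" and "\<Omega> = square L"
    and "p \<in> W1_inf \<Omega>"
    and "structured_triangulation L n x y T" and "h = mesh_size T"
    and "N = (n - 1)\<^sup>2" and "nodal_basis L n x y T \<phi>"
    and "c0inv > 0" and "\<forall>v\<in>X_N L T. h1_norm \<Omega> v \<le> c0inv / h * l2_norm \<Omega> v"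
    and "w\<^sub>N t \<in> X_NP L T"
    and "\<forall>z\<in>closed_square L. w\<^sub>N t z = (\<Sum>I<N. W t I * \<phi> I z)"
    and "0 < \<tau>"
    and "ereal \<tau> \<le> min (1 / (4 * w1_inf_norm \<Omega> p))
           (ereal (h\<^sup>2) / ereal (16 * c0inv * matrix_norm_vec N (mass_matrix \<Omega> \<phi>) (W t)))"
    and "u\<^sub>N \<in> X_NP L T" and "\<xi>\<^sub>N \<in> X_NP L T"
    and "\<phi>\<^sub>N \<in> X_NP L T" and "\<psi>\<^sub>N \<in> X_NP L T"
    and "\<forall>v\<in>X_NP L T.
           l2_inner \<Omega> (\<lambda>z. \<psi>\<^sub>N z - \<tau> * (Vvec \<Omega> u\<^sub>N z \<bullet> grad \<Omega> \<psi>\<^sub>N z)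
                            + \<tau> * (Vvec \<Omega> p z \<bullet> grad \<Omega> \<phi>\<^sub>N z)) v = l2_inner \<Omega> \<xi>\<^sub>N v"
    and "\<forall>v\<in>X_NP L T. h1_inner \<Omega> \<phi>\<^sub>N v = l2_inner \<Omega> \<psi>\<^sub>N v"
  shows "(l2_norm \<Omega> \<phi>\<^sub>N)\<^sup>2 + (l2_norm \<Omega> \<psi>\<^sub>N)\<^sup>2 \<le> 8 * (l2_norm \<Omega> \<xi>\<^sub>N)\<^sup>2"
proof -
  obtain d where d: "T = (\<Union>i<n - 1. \<Union>j<n - 1. cell_triangles x y (d i j) i j)"
    and grids: "grid_1d L n x" "grid_1d L n y"
    using assms(4) by (auto simp: structured_triangulation_def)
  interpret square_triangulation L n x y d
    using grids by unfold_locales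
  have T: "T = triangles" by (simp add: d triangles_def)
  show ?thesis
    \<comment> \<open>The evolution equation is used with the test function
      \<open>\<psi>\<^sub>N\<close>, the elliptic one with \<open>\<phi>\<^sub>N\<close>; both lie
      in the periodic space.\<close>
    using assms unfolding \<open>\<Omega> = square L\<close> T by (intro implicit_step_stability[of p \<tau> u\<^sub>N]) simp_all
qed

end
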